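(* Let $k\geq 2$ be an integer and let $p=c/n$ with a constant $0<c<c_{k+1}$. Then for every integer $m\geq 3$, $$\lim_{n\to\infty}\Pr\left[M(n,c,m)\geq m-k-2\right]=1.$$
   Context: $G(n,p)$ is the Erdős–Rényi random graph on $n$ vertices with each edge present independently with probability $p$. For a graph $G$, $D(G)=\max_H \delta(H)$ over induced subgraphs $H$ of $G$, where $\delta$ is minimum degree. For $k\ge 2$, $c_k:=\sup\{c>0:\lim_{n\to\infty}\Pr[D(G(n,c/n))\geq k]=0\}$. $K_m$ is the complete graph on $m$ vertices. For graphs $G,H$, $\mathrm{Hom}(G,H)$ is the polyhedral complex whose cells are functions $\eta:V(G)\to 2^{V(H)}\setminus\{\varnothing\}$ with $\eta(x)\times\eta(y)\subseteq E(H)$ whenever $\{x,y\}\in E(G)$; the cell $\eta$ is a product of simplices of dimension $\sum_v(|\eta(v)|-1)$, with face relation $\eta\subseteq\tau$ iff $\eta(v)\subseteq\tau(v)$ for all $v$. For a space $X$, $\mathrm{conn}(X)$ is the largest $j$ such that $X$ is $j$-connected, where $X$ is $j$-connected if it is nonempty (for $j\ge-1$) and $\pi_i(X)$ vanishes for $0\le i\le j$ (so nonempty disconnected spaces have $\mathrm{conn}=-1$). $M(n,c,m):=\mathrm{conn}[\mathrm{Hom}(G(n,c/n),K_m)]$. *)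

theory Defs
  imports "HOL-Analysis.Analysis"
begin

text \<open>Simple graphs on the vertex set {0..<n}: an edge set is a set of 2-element sets.\<close>

definition all_edges :: "nat \<Rightarrow> nat set set" where
  "all_edges n = {{u, v} | u v. u < n \<and> v < n \<and> u \<noteq> v}"

definition prob_gnp :: "nat \<Rightarrow> real \<Rightarrow> (nat set set \<Rightarrow> bool) \<Rightarrow> real" where
  "prob_gnp n p P =
     (\<Sum>E\<in>Pow (all_edges n).
        if P E then p ^ card E * (1 - p) ^ (card (all_edges n) - card E) else 0)"

definition induced_degree :: "nat set set \<Rightarrow> nat set \<Rightarrow> nat \<Rightarrow> nat" where
  "induced_degree E S v = card {u \<in> S. {u, v} \<in> E}"

definition degen :: "nat \<Rightarrow> nat set set \<Rightarrow> nat" where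
  "degen n E = Max {Min (induced_degree E S ` S) | S. S \<subseteq> {..<n} \<and> S \<noteq> {}}"

definition c_const :: "nat \<Rightarrow> ereal" where
  "c_const k = Sup {ereal c | c. c > 0 \<and>
      (\<lambda>n. prob_gnp n (c / real n) (\<lambda>E. degen n E \<ge> k)) \<longlonglongrightarrow> 0}"

definition hom_cells :: "nat \<Rightarrow> nat set set \<Rightarrow> nat \<Rightarrow> nat set set \<Rightarrow> (nat \<Rightarrow> nat set) set" where
  "hom_cells n E m EH = {\<eta>.
      (\<forall>v<n. \<eta> v \<noteq> {} \<and> \<eta> v \<subseteq> {..<m}) \<and> (\<forall>v. v \<ge> n \<longrightarrow> \<eta> v = {}) \<and>
      (\<forall>x y. {x, y} \<in> E \<longrightarrow> (\<forall>a\<in>\<eta> x. \<forall>b\<in>\<eta> y. {a, b} \<in> EH))}"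

text \<open>The closed cell of eta: the product over v in V(G) of the simplex spanned by eta(v),
  realised inside the product of simplices (Delta^{V(H)})^{V(G)} in R^(nat x nat).\<close>
definition cell_realization :: "nat \<Rightarrow> (nat \<Rightarrow> nat set) \<Rightarrow> (nat \<times> nat \<Rightarrow> real) set" where
  "cell_realization n \<eta> = {x.
      (\<forall>v w. x (v, w) \<ge> 0) \<and> (\<forall>v w. w \<notin> \<eta> v \<longrightarrow> x (v, w) = 0) \<and>
      (\<forall>v<n. (\<Sum>w\<in>\<eta> v. x (v, w)) = 1)}"

definition hom_space :: "nat \<Rightarrow> nat set set \<Rightarrow> nat \<Rightarrow> nat set set \<Rightarrow> (nat \<times> nat \<Rightarrow> real) topology" where
  "hom_space n E m EH =
     subtopology (powertop_real UNIV) (\<Union>\<eta>\<in>hom_cells n E m EH. cell_realization n \<eta>)"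

text \<open>X is j-connected: nonempty (if j >= -1) and pi_i(X) trivial for 0 <= i <= j,
  i.e. every continuous map S^i -> X is homotopic to a constant map.\<close>
definition j_connected :: "int \<Rightarrow> 'a topology \<Rightarrow> bool" where
  "j_connected j X \<longleftrightarrow>
     (j \<ge> -1 \<longrightarrow> topspace X \<noteq> {}) \<and>
     (\<forall>i::nat. int i \<le> j \<longrightarrow>
        (\<forall>f. continuous_map (nsphere i) X f \<longrightarrow>
             (\<exists>c. homotopic_with (\<lambda>_. True) (nsphere i) X f (\<lambda>_. c))))"

text \<open>conn(X) = largest j such that X is j-connected (in the extended reals, so that
  it may be +infinity).\<close>
definition conn :: "'a topology \<Rightarrow> ereal" where
  "conn X = Sup {ereal (real_of_int j) | j. j_connected j X}"

definition M_conn :: "nat \<Rightarrow> nat set set \<Rightarrow> nat \<Rightarrow> ereal" where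
  "M_conn n E m = conn (hom_space n E m (all_edges m))"

end

theory Submission
  imports Defs
begin

section \<open>Connectivity of complexes of graph colourings\<close>

text \<open>The realisation of \<open>Hom(G, K\<^sub>m)\<close> consists of all assignments of points of the standard simplex on
  \<open>m\<close> colours to the vertices such that adjacent vertices get disjoint supports. By monotonicity in
  the edge probability, \<open>D(G) \<le> k\<close> holds with probability tending to 1, so every induced subgraph of
  \<open>G\<close> has a vertex \<open>v\<close> of degree at most \<open>k\<close>. By induction along such vertices one shows: for
  \<open>p < m - k\<close>, a map from a compact \<open>A \<subseteq> B\<close> with \<open>B\<close> compact in \<open>\<real>\<^sup>p\<close> extends to \<open>B\<close>. Forget \<open>v\<close> and extend
  by induction. The extension lifts back to \<open>G\<close> wherever the neighbours of \<open>v\<close> leave some colour free.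
  The cells on which they use all \<open>m\<close> colours have dimension at least \<open>m - k > p\<close>, so the extension
  can be pushed off them without changing it on \<open>A\<close>, because \<open>p + 1\<close> or more real functions without common
  zero on a compact subset of \<open>B\<close> extend to \<open>B\<close> without common zero.\<close>

subsection \<open>Nonvanishing extensions\<close>

text \<open>The set T has dimension below \<open>DIM('a)\<close>, and maps into a sphere extend over
  polytopes of dimension at most that of the sphere. This extends the direction of f; its length is
  extended separately.\<close>

lemma nonvanishing_extension_hyperplane:
  fixes f :: "'a::euclidean_space \<Rightarrow> 'a"
  assumes "compact S" "compact T" "S \<subseteq> T" and b: "b \<in> Basis" and T: "T \<subseteq> {x. x \<bullet> b = 0}"
    and cf: "continuous_on S f" and nz: "\<And>x. x \<in> S \<Longrightarrow> f x \<noteq> 0"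
  obtains g where "continuous_on T g" "\<And>x. x \<in> T \<Longrightarrow> g x \<noteq> 0" "\<And>x. x \<in> S \<Longrightarrow> g x = f x"
proof -
  obtain a where a: "T \<subseteq> cbox (-a) a"
    using bounded_subset_cbox_symmetric compact_imp_bounded \<open>compact T\<close> by blast
  \<comment> \<open>T is only compact, while sphere-valued maps are extended over polytopes: a
    bounding box cut by the hyperplane serves as one.\<close>
  define Q where "Q = cbox (-a) a \<inter> {x. b \<bullet> x = 0}"
  have TQ: "T \<subseteq> Q"
    using a T by (auto simp: Q_def inner_commute)
  have "polyhedron Q"
    unfolding Q_def by (intro polyhedron_Int polyhedron_hyperplane polytope_imp_polyhedron polytope_interval)
  then have polyQ: "polytope Q"
    by (simp add: polytope_eq_bounded_polyhedron Q_def bounded_Int bounded_cbox)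
  have "aff_dim Q \<le> aff_dim {x. b \<bullet> x = 0}"
    by (intro aff_dim_subset) (auto simp: Q_def)
  also have "\<dots> < int DIM('a)"
    using nonzero_Basis[OF b] by simp
  also have "\<dots> = aff_dim (cball (0::'a) 1)"
    by (simp add: aff_dim_cball)
  finally have dimQ: "aff_dim Q < aff_dim (cball (0::'a) 1)" .
  have rf: "rel_frontier (cball (0::'a) 1) = sphere 0 1"
    by simp
  have cn: "continuous_on S (\<lambda>x. f x /\<^sub>R norm (f x))"
    using cf nz by (intro continuous_intros) auto
  obtain h where h: "continuous_on Q h" "h \<in> Q \<rightarrow> sphere 0 1" "\<And>x. x \<in> S \<Longrightarrow> h x = f x /\<^sub>R norm (f x)"
  proof (rule extend_map_cell_complex_to_sphere[of "{Q}" S "cball 0 1" "\<lambda>x. f x /\<^sub>R norm (f x)"])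
    show "(\<lambda>x. f x /\<^sub>R norm (f x)) \<in> S \<rightarrow> rel_frontier (cball 0 1)"
      using nz by (auto simp: rf)
  qed (use polyQ dimQ \<open>S \<subseteq> T\<close> TQ \<open>compact S\<close> cn rf in \<open>auto simp: compact_imp_closed face_of_refl polytope_imp_convex\<close>)
  \<comment> \<open>Extending the logarithm of the norm lets \<open>exp\<close> give back a positive
    length on all of T.\<close>
  have cln: "continuous_on S (\<lambda>x. ln (norm (f x)))"
    using cf nz by (intro continuous_intros) auto
  have "closedin (top_of_set T) S"
    using \<open>compact S\<close> \<open>S \<subseteq> T\<close> by (simp add: closed_subset compact_imp_closed)
  then obtain u where u: "continuous_on T u" "\<And>x. x \<in> S \<Longrightarrow> u x = ln (norm (f x))"
    by (rule Tietze_unbounded[OF cln]) blast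
  show thesis
  proof
    show "continuous_on T (\<lambda>x. exp (u x) *\<^sub>R h x)"
      using u h(1) TQ by (intro continuous_intros) (auto intro: continuous_on_subset)
    show "exp (u x) *\<^sub>R h x \<noteq> 0" if "x \<in> T" for x
    proof -
      have "norm (h x) = 1" using h(2) that TQ by (auto simp: Pi_iff)
      then show ?thesis by auto
    qed
    show "exp (u x) *\<^sub>R h x = f x" if "x \<in> S" for x
      using that nz u(2) h(3) by simp
  qed
qed

section \<open>Nonvanishing families of coordinate functions\<close>

lemma continuous_on_coordinate: "continuous_on X (\<lambda>x. x i)"
  by (rule continuous_on_product_then_coordinatewise[OF continuous_on_id])

text \<open>A copy of \<real>^p for every p inside one type, so that p may vary within a proof; the
  library spheres \<open>nsphere\<close> live in this type too.\<close>

definition coord_space :: "nat \<Rightarrow> (nat \<Rightarrow> real) set" where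
  "coord_space p = {x. \<forall>i\<ge>p. x i = 0}"

definition nonvanishing_extension_dim :: "nat \<Rightarrow> bool" where
  "nonvanishing_extension_dim d \<longleftrightarrow> (\<forall>p<d. \<forall>A B. \<forall>f :: nat \<Rightarrow> (nat \<Rightarrow> real) \<Rightarrow> real.
     compact A \<and> compact B \<and> A \<subseteq> B \<and> B \<subseteq> coord_space p \<and>
     (\<forall>i<d. continuous_on A (f i)) \<and> (\<forall>x\<in>A. \<exists>i<d. f i x \<noteq> 0) \<longrightarrow>
     (\<exists>g. (\<forall>i<d. continuous_on B (g i)) \<and> (\<forall>x\<in>B. \<exists>i<d. g i x \<noteq> 0) \<and> (\<forall>i<d. \<forall>x\<in>A. g i x = f i x)))"

text \<open>The d functions are the components of one map into \<open>'a\<close> with respect to an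
  enumerated basis, and \<open>coord_space p\<close> embeds linearly into a hyperplane of
  \<open>'a\<close> because p < d.\<close>

lemma nonvanishing_extension_dim_DIM:
  "nonvanishing_extension_dim DIM('a::euclidean_space)"
  unfolding nonvanishing_extension_dim_def
proof (intro allI impI, elim conjE)
  fix p A B and f :: "nat \<Rightarrow> (nat \<Rightarrow> real) \<Rightarrow> real"
  let ?d = "DIM('a)"
  assume p: "p < ?d" and A: "compact A" and B: "compact B" and AB: "A \<subseteq> B" and Bp: "B \<subseteq> coord_space p"
    and cf: "\<forall>i<?d. continuous_on A (f i)" and nz: "\<forall>x\<in>A. \<exists>i<?d. f i x \<noteq> 0"
  obtain h where h: "bij_betw h {..<?d} (Basis :: 'a set)"
    using ex_bij_betw_nat_finite[of "Basis :: 'a set"] by (auto simp: atLeast0LessThan)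
  have hB: "h i \<in> Basis" if "i < ?d" for i
    using h that by (auto simp: bij_betw_def)
  have hinj: "h i = h j \<longleftrightarrow> i = j" if "i < ?d" "j < ?d" for i j
    using h that by (auto simp: bij_betw_def inj_on_def)
  have hh: "h i \<bullet> h j = (if i = j then 1 else 0)" if "i < ?d" "j < ?d" for i j
    using hB[OF that(1)] hB[OF that(2)] hinj[OF that] by (auto simp: inner_Basis)
  have sum_h: "(\<Sum>i<q. c i *\<^sub>R h i) \<bullet> h j = (if j < q then c j else 0)" if "q \<le> ?d" "j < ?d" for c q j
  proof -
    have "(\<Sum>i<q. c i *\<^sub>R h i) \<bullet> h j = (\<Sum>i<q. if i = j then c j else 0)"
      unfolding inner_sum_left using that by (intro sum.cong) (auto simp: hh)
    then show ?thesis by (simp add: sum.delta)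
  qed
  \<comment> \<open>\<open>e\<close> sends p coordinates to the span of the first p basis vectors;
    \<open>e'\<close> inverts it on B.\<close>
  define e where "e = (\<lambda>x::nat \<Rightarrow> real. \<Sum>i<p. x i *\<^sub>R h i)"
  define e' where "e' = (\<lambda>y i. if i < p then y \<bullet> h i else 0)"
  have e'e: "e' (e x) = x" if "x \<in> B" for x
    using that Bp p by (auto simp: e'_def e_def fun_eq_iff coord_space_def sum_h)
  have ce: "continuous_on X e" for X
    unfolding e_def by (intro continuous_intros continuous_on_coordinate)
  have ce': "continuous_on X e'" for X
    unfolding e'_def
  proof (rule continuous_on_coordinatewise_then_product)
    show "continuous_on X (\<lambda>y. if i < p then y \<bullet> h i else 0)" for i
      by (cases "i < p") (auto intro!: continuous_intros)
  qed
  define F where "F = (\<lambda>y. \<Sum>i<?d. f i (e' y) *\<^sub>R h i)"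
  have Fh: "F y \<bullet> h i = f i (e' y)" if "i < ?d" for y i
    using that by (simp add: F_def sum_h)
  have im: "e' ` e ` A \<subseteq> A"
    using e'e AB by auto
  have cF: "continuous_on (e ` A) F"
    unfolding F_def
    by (intro continuous_on_sum continuous_on_scaleR continuous_on_const
        continuous_on_compose2[OF _ ce' im]) (use cf in auto)
  have Fnz: "F y \<noteq> 0" if "y \<in> e ` A" for y
  proof -
    have "e' y \<in> A" using im that by blast
    then obtain i where i: "i < ?d" "f i (e' y) \<noteq> 0"
      using nz by blast
    then have "F y \<bullet> h i \<noteq> 0" by (simp add: Fh)
    then show ?thesis by auto
  qed
  have 1: "compact (e ` A)" "compact (e ` B)" "e ` A \<subseteq> e ` B"
    using A B AB ce by (auto intro: compact_continuous_image)
  \<comment> \<open>The basis vector \<open>h p\<close> exists since p < d, and it is orthogonal to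
    the vectors used by \<open>e\<close>.\<close>
  have 2: "e ` B \<subseteq> {x. x \<bullet> h p = 0}"
    using p by (auto simp: e_def sum_h)
  obtain G where G: "continuous_on (e ` B) G" "\<And>x. x \<in> e ` B \<Longrightarrow> G x \<noteq> 0" "\<And>x. x \<in> e ` A \<Longrightarrow> G x = F x"
    using nonvanishing_extension_hyperplane[OF 1 hB[OF p] 2 cF Fnz] by metis
  show "\<exists>g. (\<forall>i<?d. continuous_on B (g i)) \<and> (\<forall>x\<in>B. \<exists>i<?d. g i x \<noteq> 0) \<and> (\<forall>i<?d. \<forall>x\<in>A. g i x = f i x)"
  proof (intro exI[of _ "\<lambda>i x. G (e x) \<bullet> h i"] conjI allI impI ballI)
    show "continuous_on B (\<lambda>x. G (e x) \<bullet> h i)" for i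
      by (intro continuous_intros continuous_on_compose2[OF G(1) ce]) auto
    show "G (e x) \<bullet> h i = f i x" if "i < ?d" "x \<in> A" for i x
      using that AB by (simp add: G(3) Fh e'e subset_iff)
    show "\<exists>i<?d. G (e x) \<bullet> h i \<noteq> 0" if "x \<in> B" for x
    proof (rule ccontr)
      assume *: "\<not> ?thesis"
      have "G (e x) \<bullet> b = 0" if "b \<in> Basis" for b
        using * that h by (metis bij_betw_iff_bijections lessThan_iff)
      then have "G (e x) = 0" using euclidean_all_zero_iff[of "G (e x)"] by blast
      then show False using G(2)[of "e x"] that by simp
    qed
  qed
qed

text \<open>The preceding lemma covers a dimension \<open>d\<close> only when some type has \<open>d\<close> basis vectors, and \<open>d\<close>
  cannot be turned into a type inside a proof. So let \<open>critical_dim\<close> be a counterexample whenever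
  there is one: a type with that many elements then refutes the existence of counterexamples.\<close>

definition critical_dim :: nat where
  "critical_dim = (SOME d. 0 < d \<and> (nonvanishing_extension_dim d \<longrightarrow> (\<forall>d>0. nonvanishing_extension_dim d)))"

lemma critical_dim: "0 < critical_dim"
  "nonvanishing_extension_dim critical_dim \<Longrightarrow> 0 < d \<Longrightarrow> nonvanishing_extension_dim d"
proof -
  \<comment> \<open>A counterexample satisfies the implication vacuously; if there is none, d = 1
    does.\<close>
  have "\<exists>d. 0 < d \<and> (nonvanishing_extension_dim d \<longrightarrow> (\<forall>d>0. nonvanishing_extension_dim d))"
    by (metis zero_less_one)
  from someI_ex[OF this, folded critical_dim_def]
  show "0 < critical_dim"
    "nonvanishing_extension_dim critical_dim \<Longrightarrow> 0 < d \<Longrightarrow> nonvanishing_extension_dim d"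
    by auto
qed

typedef critical_index = "{..<critical_dim}"
  using critical_dim(1) by blast

instance critical_index :: finite
  by standard (simp add: type_definition.univ[OF type_definition_critical_index])

lemma CARD_critical_index: "CARD(critical_index) = critical_dim"
  by (simp add: type_definition.card[OF type_definition_critical_index])

lemma nonvanishing_extension_dim: "nonvanishing_extension_dim d"
proof (cases "d = 0")
  case False
  have "nonvanishing_extension_dim critical_dim"
    using nonvanishing_extension_dim_DIM[where 'a = "real ^ critical_index"]
    by (simp add: CARD_critical_index)
  then show ?thesis using critical_dim(2) False by blast
qed (simp add: nonvanishing_extension_dim_def)

lemma nonvanishing_extension:
  fixes f :: "'i \<Rightarrow> (nat \<Rightarrow> real) \<Rightarrow> real"
  assumes I: "finite I" "p < card I" and "compact A" "compact B" "A \<subseteq> B" "B \<subseteq> coord_space p"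
    and cf: "\<And>i. i \<in> I \<Longrightarrow> continuous_on A (f i)" and nz: "\<And>x. x \<in> A \<Longrightarrow> \<exists>i\<in>I. f i x \<noteq> 0"
  shows "\<exists>g. (\<forall>i\<in>I. continuous_on B (g i)) \<and> (\<forall>x\<in>B. \<exists>i\<in>I. g i x \<noteq> 0) \<and>
    (\<forall>i\<in>I. \<forall>x\<in>A. g i x = f i x)"
proof -
  obtain h where h: "bij_betw h {..<card I} I"
    using ex_bij_betw_nat_finite[OF I(1)] by (auto simp: atLeast0LessThan)
  define h' where "h' = the_inv_into {..<card I} h"
  have h': "h' i < card I" "h (h' i) = i" if "i \<in> I" for i
    using h that the_inv_into_into[of h "{..<card I}" i "{..<card I}"] f_the_inv_into_f[of h "{..<card I}" i]
    by (auto simp: bij_betw_def h'_def)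
  have hI: "h j \<in> I" if "j < card I" for j
    using h that by (auto simp: bij_betw_def)
  have "\<forall>j<card I. continuous_on A (f (h j))" "\<forall>x\<in>A. \<exists>j<card I. f (h j) x \<noteq> 0"
    using cf nz hI h' by (auto, metis)
  then obtain g where g: "\<forall>j<card I. continuous_on B (g j)" "\<forall>x\<in>B. \<exists>j<card I. g j x \<noteq> 0"
      "\<forall>j<card I. \<forall>x\<in>A. g j x = f (h j) x"
    using nonvanishing_extension_dim[of "card I", unfolded nonvanishing_extension_dim_def, rule_format,
        of p A B "\<lambda>j. f (h j)"] assms by auto
  have hh: "h' (h j) = j" if "j < card I" for j
    using h that by (simp add: h'_def the_inv_into_f_f bij_betw_def)
  have "\<exists>i\<in>I. g (h' i) x \<noteq> 0" if "x \<in> B" for x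
    using g(2) that hI hh by metis
  then show ?thesis
    using g(1,3) h' by (intro exI[of _ "\<lambda>i. g (h' i)"]) auto
qed

subsection \<open>Pushing maps off cells of large dimension\<close>

lemma continuous_on_Max:
  fixes f :: "'i \<Rightarrow> 'a::topological_space \<Rightarrow> real"
  assumes "finite I" "I \<noteq> {}" "\<And>i. i \<in> I \<Longrightarrow> continuous_on K (f i)"
  shows "continuous_on K (\<lambda>x. Max ((\<lambda>i. f i x) ` I))"
  using assms
proof (induction rule: finite_ne_induct)
  case (insert i I)
  then have "(\<lambda>x. Max ((\<lambda>j. f j x) ` insert i I)) = (\<lambda>x. max (f i x) (Max ((\<lambda>j. f j x) ` I)))"
    by simp
  with insert show ?case by (simp add: continuous_on_max)
qed simp

text \<open>Coordinates outside S and the m colours are zero, so the products for all vertex sets S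
  share one type and deleting a vertex means zeroing its coordinates.\<close>

definition simplex_prod :: "nat set \<Rightarrow> nat \<Rightarrow> (nat \<times> nat \<Rightarrow> real) set" where
  "simplex_prod S m = {x. (\<forall>i. 0 \<le> x i) \<and> (\<forall>i. i \<notin> S \<times> {..<m} \<longrightarrow> x i = 0) \<and>
     (\<forall>v\<in>S. (\<Sum>a<m. x (v, a)) = 1)}"

text \<open>For a point of a product of simplices this is the cell having the point in its relative
  interior. Cells are thus sets of vertex-colour pairs, of dimension
  \<open>card \<eta> - card S\<close>.\<close>

definition supp :: "('i \<Rightarrow> real) \<Rightarrow> 'i set" where
  "supp x = {i. x i \<noteq> 0}"

lemma simplex_prodD:
  assumes "x \<in> simplex_prod S m"
  shows "0 \<le> x i" "i \<notin> S \<times> {..<m} \<Longrightarrow> x i = 0" "v \<in> S \<Longrightarrow> (\<Sum>a<m. x (v, a)) = 1"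
  using assms unfolding simplex_prod_def by blast+

lemma supp_simplex_prod: "x \<in> simplex_prod S m \<Longrightarrow> supp x \<subseteq> S \<times> {..<m}"
  by (auto simp: supp_def simplex_prod_def)

text \<open>Recentred at the barycentre, the coordinates of \<open>\<eta>\<close> outside a section of \<open>\<eta> \<rightarrow> S\<close> are
  \<open>card \<eta> - card S > p\<close> functions without common zero on the boundary of the cell. Extend them
  without common zero, then project radially from the barycentre onto the boundary.\<close>

lemma push_off_cell:
  fixes g :: "(nat \<Rightarrow> real) \<Rightarrow> nat \<times> nat \<Rightarrow> real"
  assumes S: "finite S" and \<eta>: "\<eta> \<subseteq> S \<times> {..<m}" and dim: "p + card S < card \<eta>"
    and B: "compact B" "B \<subseteq> coord_space p" and cg: "continuous_on B g"
    and gP: "\<And>s. s \<in> B \<Longrightarrow> g s \<in> simplex_prod S m"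
    and maximal: "\<And>s. s \<in> B \<Longrightarrow> \<eta> \<subseteq> supp (g s) \<Longrightarrow> supp (g s) = \<eta>"
  shows "\<exists>g'. continuous_on B g' \<and> (\<forall>s\<in>B. if supp (g s) = \<eta>
    then g' s \<in> simplex_prod S m \<and> supp (g' s) \<subset> \<eta> else g' s = g s)"
proof (cases "\<exists>s\<in>B. supp (g s) = \<eta>")
  case False
  then show ?thesis using cg by (intro exI[of _ g]) auto
next
  case True
  then obtain s0 where s0: "s0 \<in> B" "supp (g s0) = \<eta>" by blast
  have fin\<eta>: "finite \<eta>"
    using S \<eta> finite_subset by blast
  have "\<exists>a. (v, a) \<in> \<eta>" if "v \<in> S" for v
  proof (rule ccontr)
    assume "\<not> ?thesis"
    then have "g s0 (v, a) = 0" for a using s0 by (auto simp: supp_def)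
    then show False using gP[OF s0(1)] that by (auto simp: simplex_prod_def)
  qed
  then obtain \<alpha> where \<alpha>: "\<And>v. v \<in> S \<Longrightarrow> (v, \<alpha> v) \<in> \<eta>" by metis
  \<comment> \<open>\<open>F v\<close> is the factor of the cell at v, and the barycentre has all
    its coordinates at v equal to \<open>1 / c v\<close>.\<close>
  define F where "F = (\<lambda>v. {a. (v, a) \<in> \<eta>})"
  define c where "c = (\<lambda>v. real (card (F v)))"
  have F: "finite (F v)" "F v \<subseteq> {..<m}" for v
    using \<eta> by (auto simp: F_def intro: finite_subset[of _ "{..<m}"])
  have \<alpha>F: "\<alpha> v \<in> F v" if "v \<in> S" for v using \<alpha> that by (simp add: F_def)
  have c: "c v > 0" if "v \<in> S" for v
    using \<alpha>F[OF that] F(1) by (auto simp: c_def card_gt_0_iff)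
  have \<eta>S: "v \<in> S" if "(v, a) \<in> \<eta>" for v a using \<eta> that by auto
  \<comment> \<open>Over each vertex the weights sum to 1, so one coordinate per vertex is
    redundant; \<open>I\<close> keeps the others, as many as the dimension of the cell.\<close>
  define J where "J = (\<lambda>v. (v, \<alpha> v)) ` S"
  define I where "I = \<eta> - J"
  have JI: "J \<subseteq> \<eta>" using \<alpha> by (auto simp: J_def)
  have "card J = card S" by (simp add: J_def card_image inj_on_def)
  then have cardI: "p < card I"
    using dim JI fin\<eta> by (simp add: I_def card_Diff_subset finite_subset)
  have finI: "finite I" using fin\<eta> by (simp add: I_def)
  have II: "(v, a) \<in> I \<longleftrightarrow> (v, a) \<in> \<eta> \<and> a \<noteq> \<alpha> v" for v a
    using \<eta>S by (auto simp: I_def J_def)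
  have cgi: "continuous_on B (\<lambda>s. g s i)" for i
    using continuous_on_product_then_coordinatewise[OF cg] .
  \<comment> \<open>K is the preimage of the closed cell and U that of the complement of the open
    cell. A vanishing sum of nonnegative terms and a vanishing product express both as closed
    conditions; for U this relies on \<open>maximal\<close>.\<close>
  define K where "K = {s\<in>B. (\<Sum>i\<in>S \<times> {..<m} - \<eta>. g s i) = 0}"
  define U where "U = {s\<in>B. (\<Prod>i\<in>\<eta>. g s i) = 0}"
  have "closed B" using B(1) by (rule compact_imp_closed)
  then have "closed K" "closed U"
    unfolding K_def U_def
    by (auto intro!: continuous_closed_preimage_constant continuous_on_sum continuous_on_prod cgi)
  have KB: "K \<subseteq> B" "U \<subseteq> B" by (auto simp: K_def U_def)
  have "compact K" "compact (K \<inter> U)"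
    using compact_Int_closed[OF B(1) \<open>closed K\<close>] compact_Int_closed[OF B(1) closed_Int[OF \<open>closed K\<close> \<open>closed U\<close>]]
      KB by (simp_all add: Int_absorb1 le_infI1)
  have K: "s \<in> K \<longleftrightarrow> s \<in> B \<and> supp (g s) \<subseteq> \<eta>" for s
  proof -
    have "(\<Sum>i\<in>S \<times> {..<m} - \<eta>. g s i) = 0 \<longleftrightarrow> (\<forall>i\<in>S \<times> {..<m} - \<eta>. g s i = 0)" if "s \<in> B"
      using gP[OF that] S by (intro sum_nonneg_eq_0_iff) (auto simp: simplex_prod_def)
    moreover have "(\<forall>i\<in>S \<times> {..<m} - \<eta>. g s i = 0) \<longleftrightarrow> supp (g s) \<subseteq> \<eta>" if "s \<in> B"
      using supp_simplex_prod[OF gP[OF that]] by (auto simp: supp_def)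
    ultimately show ?thesis unfolding K_def by auto
  qed
  have U: "s \<in> U \<longleftrightarrow> s \<in> B \<and> supp (g s) \<noteq> \<eta>" for s
  proof -
    have "(\<Prod>i\<in>\<eta>. g s i) = 0 \<longleftrightarrow> \<not> \<eta> \<subseteq> supp (g s)"
      using fin\<eta> by (auto simp: supp_def)
    then show ?thesis unfolding U_def using maximal by auto
  qed
  have BKU: "B = K \<union> U"
    using K U KB by auto
  define f where "f = (\<lambda>i s. g s i - 1 / c (fst i))"
  have sum_supp: "(\<Sum>a\<in>F v. g s (v, a)) = 1" if "s \<in> K" "v \<in> S" for s v
  proof -
    have "(\<Sum>a\<in>F v. g s (v, a)) = (\<Sum>a<m. g s (v, a))"
      using F that(1) K[of s] by (intro sum.mono_neutral_left) (auto simp: F_def supp_def)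
    then show ?thesis using gP[of s] K that by (auto simp: simplex_prod_def)
  qed
  have split: "sum q (F v) = q (\<alpha> v) + sum q (F v - {\<alpha> v})" if "v \<in> S" for v and q :: "nat \<Rightarrow> real"
    using F(1) \<alpha>F[OF that] by (rule sum.remove)
  have f\<alpha>: "f (v, \<alpha> v) s = - (\<Sum>a\<in>F v - {\<alpha> v}. f (v, a) s)" if "s \<in> K" "v \<in> S" for s v
  proof -
    have "(\<Sum>a\<in>F v. f (v, a) s) = 1 - real (card (F v)) * (1 / c v)"
      using sum_supp[OF that] by (simp add: f_def sum_subtractf)
    also have "\<dots> = 0" using c[OF that(2)] by (simp add: c_def)
    finally show ?thesis using split[OF that(2), of "\<lambda>a. f (v, a) s"] by simp
  qed
  \<comment> \<open>If all of these vanish, so do the redundant ones, and \<open>g s\<close> is the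
    barycentre. Its support is all of \<eta>, which U excludes.\<close>
  have "\<exists>i\<in>I. f i s \<noteq> 0" if s: "s \<in> K \<inter> U" for s
  proof (rule ccontr)
    assume *: "\<not> ?thesis"
    have "f (v, a) s = 0" if "(v, a) \<in> \<eta>" for v a
    proof (cases "a = \<alpha> v")
      case True
      then show ?thesis using f\<alpha>[of s v] s * that \<eta>S by (auto simp: II F_def intro!: sum.neutral)
    next
      case False
      then show ?thesis using * that II by blast
    qed
    then have "g s i > 0" if "i \<in> \<eta>" for i
      using that c \<eta>S by (cases i) (force simp: f_def)
    then have "\<eta> \<subseteq> supp (g s)" by (force simp: supp_def)
    then show False using s K U by auto
  qed
  then have fnz: "\<And>s. s \<in> K \<inter> U \<Longrightarrow> \<exists>i\<in>I. f i s \<noteq> 0" .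
  have cf: "continuous_on (K \<inter> U) (f i)" for i
    unfolding f_def by (intro continuous_intros continuous_on_subset[OF cgi]) (use KB in auto)
  have Kp: "K \<subseteq> coord_space p" using KB B by auto
  obtain h where h: "\<And>i. i \<in> I \<Longrightarrow> continuous_on K (h i)"
      "\<And>s. s \<in> K \<Longrightarrow> \<exists>i\<in>I. h i s \<noteq> 0" "\<And>i s. i \<in> I \<Longrightarrow> s \<in> K \<inter> U \<Longrightarrow> h i s = f i s"
    using nonvanishing_extension[OF finI cardI \<open>compact (K \<inter> U)\<close> \<open>compact K\<close> Int_lower1 Kp cf fnz] by blast
  \<comment> \<open>The redundant coordinates are restored so that the sum over each vertex is zero:
    H is a direction tangent to the cell.\<close>
  define H where "H = (\<lambda>(v, a) s. if a = \<alpha> v then - (\<Sum>b\<in>F v - {\<alpha> v}. h (v, b) s) else h (v, a) s)"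
  have H\<alpha>: "H (v, \<alpha> v) = (\<lambda>s. - (\<Sum>b\<in>F v - {\<alpha> v}. h (v, b) s))" for v
    by (simp add: H_def)
  have HI: "H i = h i" if "i \<in> I" for i
    using that by (cases i) (auto simp: H_def II)
  have FI: "(v, b) \<in> I" if "b \<in> F v - {\<alpha> v}" for v b
    using that by (auto simp: II F_def)
  have \<eta>_cases: "i \<in> I \<or> (\<exists>v\<in>S. i = (v, \<alpha> v))" if "i \<in> \<eta>" for i
    using that by (auto simp: I_def J_def)
  have cH: "continuous_on K (H i)" if "i \<in> \<eta>" for i
    using \<eta>_cases[OF that]
  proof
    show ?thesis if "i \<in> I" using that h(1) HI by simp
    show ?thesis if "\<exists>v\<in>S. i = (v, \<alpha> v)"
      using that by (auto simp: H\<alpha> simp del: sum_negf intro!: continuous_on_minus continuous_on_sum h(1)[rule_format] FI)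
  qed
  have H0: "(\<Sum>a\<in>F v. H (v, a) s) = 0" if "v \<in> S" for v s
    using split[OF that, of "\<lambda>a. H (v, a) s"] by (simp add: H_def)
  have HA: "H i s = f i s" if "i \<in> \<eta>" "s \<in> K \<inter> U" for i s
    using \<eta>_cases[OF that(1)]
  proof
    show ?thesis if "i \<in> I" using that h(3) HI \<open>s \<in> K \<inter> U\<close> by simp
    assume "\<exists>v\<in>S. i = (v, \<alpha> v)"
    then obtain v where v: "v \<in> S" "i = (v, \<alpha> v)" by blast
    have "(\<Sum>b\<in>F v - {\<alpha> v}. h (v, b) s) = (\<Sum>b\<in>F v - {\<alpha> v}. f (v, b) s)"
      using h(3) FI that(2) by (intro sum.cong) auto
    then show ?thesis using f\<alpha>[of s v] that(2) v by (simp add: H\<alpha>)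
  qed
  \<comment> \<open>The ray from the barycentre along H leaves the cell at parameter
    \<open>1 / \<gamma> s\<close>: with \<gamma> positive,
    \<open>1 / c + H / \<gamma> \<ge> 0\<close> means \<open>- H * c \<le> \<gamma>\<close>.\<close>
  define \<gamma> where "\<gamma> = (\<lambda>s. Max ((\<lambda>i. - H i s * c (fst i)) ` \<eta>))"
  have \<eta>ne: "\<eta> \<noteq> {}" using dim by auto
  have \<gamma>ge: "- H i s * c (fst i) \<le> \<gamma> s" if "i \<in> \<eta>" for i s
    unfolding \<gamma>_def using that fin\<eta> by (intro Max_ge) auto
  have \<gamma>ex: "\<exists>i\<in>\<eta>. - H i s * c (fst i) = \<gamma> s" for s
  proof -
    have "\<gamma> s \<in> (\<lambda>i. - H i s * c (fst i)) ` \<eta>"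
      unfolding \<gamma>_def using fin\<eta> \<eta>ne by (intro Max_in) auto
    then show ?thesis by force
  qed
  have c\<gamma>: "continuous_on K \<gamma>"
    unfolding \<gamma>_def using fin\<eta> \<eta>ne by (intro continuous_on_Max continuous_intros cH)
  \<comment> \<open>Some coordinate of H is nonzero, and coordinates with zero sum that do not all
    vanish include a negative one.\<close>
  have \<gamma>pos: "\<gamma> s > 0" if s: "s \<in> K" for s
  proof -
    obtain v a where va: "(v, a) \<in> I" "h (v, a) s \<noteq> 0" using h(2)[OF s] by auto
    then have "H (v, a) s \<noteq> 0" "a \<in> F v" and v: "v \<in> S" using \<eta>S by (auto simp: H_def II F_def)
    then have "\<exists>b\<in>F v. H (v, b) s < 0"
      using H0[OF v, of s] sum_nonneg_eq_0_iff[OF F(1), of v "\<lambda>b. H (v, b) s"] by (meson not_le)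
    then obtain b where b: "(v, b) \<in> \<eta>" "H (v, b) s < 0" by (auto simp: F_def)
    then have "0 < - H (v, b) s * c v" using c[OF v] by (simp add: mult_neg_pos)
    then show ?thesis using \<gamma>ge[OF b(1), of s] by simp
  qed
  define k where "k = (\<lambda>s i. if i \<in> \<eta> then 1 / c (fst i) + H i s / \<gamma> s else 0)"
  have ck: "continuous_on K k"
    unfolding k_def
  proof (rule continuous_on_coordinatewise_then_product)
    show "continuous_on K (\<lambda>s. if i \<in> \<eta> then 1 / c (fst i) + H i s / \<gamma> s else 0)" for i
      using cH[of i] c\<gamma> \<gamma>pos by (cases "i \<in> \<eta>") (auto intro!: continuous_intros simp: less_le)
  qed
  \<comment> \<open>A point already on the boundary has a zero coordinate and no negative one; hence
    \<gamma> = 1 and the projection fixes it.\<close>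
  have kA: "k s = g s" if s: "s \<in> K \<inter> U" for s
  proof -
    have g0: "g s i \<ge> 0" for i
    proof -
      have "s \<in> B" using s KB by auto
      then show ?thesis using gP simplex_prodD(1) by blast
    qed
    have c0: "c (fst i) > 0" if "i \<in> \<eta>" for i using c \<eta>S that by (cases i) auto
    have HA': "- H i s * c (fst i) = 1 - g s i * c (fst i)" if "i \<in> \<eta>" for i
      using HA[OF that s] c0[OF that] by (simp add: f_def field_simps)
    obtain j where j: "j \<in> \<eta>" "- H j s * c (fst j) = \<gamma> s"
      using \<gamma>ex by blast
    have "0 \<le> g s j * c (fst j)"
      using g0[of j] c0[OF j(1)] by simp
    then have "\<gamma> s \<le> 1"
      using j(2) HA'[OF j(1)] by linarith
    moreover obtain i where "i \<in> \<eta>" "g s i = 0"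
      using s K[of s] U[of s] by (auto simp: supp_def)
    then have "1 \<le> \<gamma> s" using \<gamma>ge[of i s] HA'[of i] by simp
    ultimately have "\<gamma> s = 1" by simp
    then show ?thesis
      using HA s K[of s] by (auto simp: k_def fun_eq_iff f_def supp_def)
  qed
  have kP: "k s \<in> simplex_prod S m \<and> supp (k s) \<subset> \<eta>" if s: "s \<in> K" for s
  proof -
    have c0: "c (fst i) > 0" if "i \<in> \<eta>" for i using c \<eta>S that by (cases i) auto
    have keq: "k s i = (\<gamma> s - (- H i s * c (fst i))) / (c (fst i) * \<gamma> s)" if "i \<in> \<eta>" for i
      using \<gamma>pos[OF s] c0[OF that] that by (simp add: k_def field_simps)
    have "0 \<le> k s i" for i
    proof (cases "i \<in> \<eta>")
      case True
      then show ?thesis unfolding keq[OF True]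
        using \<gamma>ge[OF True, of s] \<gamma>pos[OF s] c0[OF True] by (intro divide_nonneg_pos) auto
    qed (simp add: k_def)
    moreover have "(\<Sum>a<m. k s (v, a)) = 1" if "v \<in> S" for v
    proof -
      have "(\<Sum>a<m. k s (v, a)) = (\<Sum>a\<in>F v. k s (v, a))"
        using F by (intro sum.mono_neutral_right) (auto simp: F_def k_def)
      also have "\<dots> = (\<Sum>a\<in>F v. 1 / c v + H (v, a) s / \<gamma> s)"
        by (intro sum.cong) (auto simp: F_def k_def)
      also have "\<dots> = 1"
        using c[OF that] by (simp add: sum.distrib flip: sum_divide_distrib) (simp add: H0[OF that] c_def)
      finally show ?thesis .
    qed
    moreover have "supp (k s) \<subseteq> \<eta>" by (auto simp: supp_def k_def)
    \<comment> \<open>The coordinate attaining the maximum \<gamma> becomes zero, so the support is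
      a proper subset of \<eta>.\<close>
    moreover obtain i where "i \<in> \<eta>" "k s i = 0"
      using \<gamma>ex[of s] keq by (metis diff_self div_0)
    then have "supp (k s) \<noteq> \<eta>" by (auto simp: supp_def)
    ultimately show ?thesis using \<eta> by (auto simp: simplex_prod_def supp_def)
  qed
  show ?thesis
  proof (intro exI conjI ballI)
    show "continuous_on B (\<lambda>s. if s \<in> K then k s else g s)"
      unfolding BKU
    proof (rule continuous_on_cases[OF \<open>closed K\<close> \<open>closed U\<close> ck])
      show "continuous_on U g" using cg KB continuous_on_subset by blast
    qed (use kA in auto)
    show "if supp (g s) = \<eta> then (if s \<in> K then k s else g s) \<in> simplex_prod S m \<and>
        supp (if s \<in> K then k s else g s) \<subset> \<eta> else (if s \<in> K then k s else g s) = g s" if "s \<in> B" for s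
      using kA[of s] kP[of s] U[of s] K[of s] that by auto
  qed
qed

text \<open>Bad cells are cleared one at a time, from maximal ones downwards. Pushing off a cell
  only moves points into its proper faces, so the cell is not met again. The finite set T holds the
  bad cells that may still be met.\<close>

lemma push_off_cells:
  fixes g :: "(nat \<Rightarrow> real) \<Rightarrow> nat \<times> nat \<Rightarrow> real"
  assumes S: "finite S" and bad: "bad \<subseteq> Pow (S \<times> {..<m})"
    and up: "\<And>\<eta> \<eta>'. \<eta> \<in> bad \<Longrightarrow> \<eta> \<subseteq> \<eta>' \<Longrightarrow> \<eta>' \<subseteq> S \<times> {..<m} \<Longrightarrow> \<eta>' \<in> bad"
    and dim: "\<And>\<eta>. \<eta> \<in> bad \<Longrightarrow> p + card S < card \<eta>"
    and B: "compact B" "B \<subseteq> coord_space p" and cg: "continuous_on B g"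
    and gP: "\<And>s. s \<in> B \<Longrightarrow> g s \<in> simplex_prod S m"
  shows "\<exists>g'. continuous_on B g' \<and> (\<forall>s\<in>B. g' s \<in> simplex_prod S m \<and> supp (g' s) \<subseteq> supp (g s) \<and>
    supp (g' s) \<notin> bad \<and> (supp (g s) \<notin> bad \<longrightarrow> g' s = g s))"
proof -
  have "\<exists>g'. continuous_on B g' \<and> (\<forall>s\<in>B. g' s \<in> simplex_prod S m \<and> supp (g' s) \<subseteq> supp (g s) \<and>
    supp (g' s) \<notin> bad \<and> (supp (g s) \<notin> bad \<longrightarrow> g' s = g s))"
    if "finite T" "T \<subseteq> bad" "\<And>\<eta> \<eta>'. \<eta> \<in> T \<Longrightarrow> \<eta>' \<subseteq> \<eta> \<Longrightarrow> \<eta>' \<in> bad \<Longrightarrow> \<eta>' \<in> T"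
      "continuous_on B g" "\<And>s. s \<in> B \<Longrightarrow> g s \<in> simplex_prod S m"
      "\<And>s. s \<in> B \<Longrightarrow> supp (g s) \<in> bad \<Longrightarrow> supp (g s) \<in> T" for T and g :: "(nat \<Rightarrow> real) \<Rightarrow> nat \<times> nat \<Rightarrow> real"
    using that
  proof (induction "card T" arbitrary: T g)
    case 0
    then have "\<forall>s\<in>B. supp (g s) \<notin> bad" by auto
    then show ?case using 0(5,6) by (intro exI[of _ g]) simp
  next
    case (Suc n)
    then have "T \<noteq> {}" by auto
    then obtain \<eta> where \<eta>: "\<eta> \<in> T" "\<And>\<eta>'. \<eta>' \<in> T \<Longrightarrow> \<eta> \<subseteq> \<eta>' \<Longrightarrow> \<eta> = \<eta>'"
      using finite_has_maximal[OF \<open>finite T\<close> \<open>T \<noteq> {}\<close>] by auto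
    have \<eta>bad: "\<eta> \<in> bad" "\<eta> \<subseteq> S \<times> {..<m}" using \<eta> Suc.prems bad by auto
    \<comment> \<open>A support containing \<eta> is bad since \<open>bad\<close> is closed upwards,
      hence lies in T, where \<eta> is maximal.\<close>
    have mx: "supp (g s) = \<eta>" if "s \<in> B" "\<eta> \<subseteq> supp (g s)" for s
    proof -
      have "supp (g s) \<subseteq> S \<times> {..<m}" using supp_simplex_prod Suc.prems(5)[OF that(1)] .
      then have "supp (g s) \<in> T" using up[OF \<eta>bad(1) that(2)] Suc.prems(6)[OF that(1)] by simp
      then show ?thesis by (rule \<eta>(2)[OF _ that(2), symmetric])
    qed
    obtain g1 where g1: "continuous_on B g1" "\<forall>s\<in>B. if supp (g s) = \<eta>
        then g1 s \<in> simplex_prod S m \<and> supp (g1 s) \<subset> \<eta> else g1 s = g s"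
      using push_off_cell[OF S \<eta>bad(2) dim[OF \<eta>bad(1)] B Suc.prems(4) Suc.prems(5) mx] by blast
    have g1_eq: "g1 s = g s" if "s \<in> B" "supp (g s) \<noteq> \<eta>" for s
      using g1(2) that by simp
    have g1_cell: "g1 s \<in> simplex_prod S m" "supp (g1 s) \<subset> \<eta>" if "s \<in> B" "supp (g s) = \<eta>" for s
      using g1(2) that by simp_all
    have g1P: "g1 s \<in> simplex_prod S m" if "s \<in> B" for s
      using g1_eq[OF that] g1_cell(1)[OF that] Suc.prems(5)[OF that] by (cases "supp (g s) = \<eta>") auto
    have 1: "n = card (T - {\<eta>})" using Suc.hyps(2) \<eta>(1) Suc.prems(1) by simp
    have 2: "supp (g1 s) \<in> T - {\<eta>}" if "s \<in> B" "supp (g1 s) \<in> bad" for s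
    proof (cases "supp (g s) = \<eta>")
      case True
      then show ?thesis using g1_cell(2)[OF that(1) True] Suc.prems(3)[OF \<eta>(1) _ that(2)] by auto
    next
      case False
      then show ?thesis using g1_eq[OF that(1) False] Suc.prems(6) that by auto
    qed
    have 3: "\<xi>' \<in> T - {\<eta>}" if "\<xi> \<in> T - {\<eta>}" "\<xi>' \<subseteq> \<xi>" "\<xi>' \<in> bad" for \<xi> \<xi>'
      using that \<eta>(2) Suc.prems(3) by blast
    have "\<exists>g'. continuous_on B g' \<and> (\<forall>s\<in>B. g' s \<in> simplex_prod S m \<and> supp (g' s) \<subseteq> supp (g1 s) \<and>
       supp (g' s) \<notin> bad \<and> (supp (g1 s) \<notin> bad \<longrightarrow> g' s = g1 s))"
    proof (rule Suc.hyps(1)[OF 1 _ _ _ g1(1)])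
      show "finite (T - {\<eta>})" "T - {\<eta>} \<subseteq> bad" using Suc.prems(1,2) by auto
    qed (fact 2 3 g1P)+
    then obtain g' where g': "continuous_on B g'" "\<forall>s\<in>B. g' s \<in> simplex_prod S m \<and> supp (g' s) \<subseteq> supp (g1 s) \<and>
       supp (g' s) \<notin> bad \<and> (supp (g1 s) \<notin> bad \<longrightarrow> g' s = g1 s)"
      by blast
    show ?case
    proof (intro exI[of _ g'] conjI ballI impI)
      fix s assume s: "s \<in> B"
      have le: "supp (g1 s) \<subseteq> supp (g s)"
        using g1_eq[OF s] g1_cell(2)[OF s] by (cases "supp (g s) = \<eta>") auto
      show "g' s \<in> simplex_prod S m" "supp (g' s) \<subseteq> supp (g s)" "supp (g' s) \<notin> bad"
        using g'(2) s le by auto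
      show "g' s = g s" if "supp (g s) \<notin> bad"
      proof -
        have "g1 s = g s" using g1_eq[OF s] that \<eta>bad(1) by auto
        then show ?thesis using g'(2) s that by simp
      qed
    qed (use g' in simp)
  qed
  moreover have "finite bad"
    using bad S by (auto intro: finite_subset)
  ultimately show ?thesis
    using cg gP by simp
qed

subsection \<open>The extension property of colouring spaces\<close>

text \<open>The realisation of the Hom complex of the subgraph induced on S; S is a parameter
  because the induction deletes vertices.\<close>

definition coloring_space :: "nat set set \<Rightarrow> nat \<Rightarrow> nat set \<Rightarrow> (nat \<times> nat \<Rightarrow> real) set" where
  "coloring_space E m S = {x \<in> simplex_prod S m.
     \<forall>u\<in>S. \<forall>v\<in>S. {u, v} \<in> E \<longrightarrow> (\<forall>a. x (u, a) = 0 \<or> x (v, a) = 0)}"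

section \<open>Lifting a map over a deleted vertex\<close>

lemma vanishing_bump:
  fixes A :: "'a::metric_space set"
  assumes "closed A" "0 < \<epsilon>"
  obtains l :: "'a \<Rightarrow> real" where "continuous_on UNIV l" "\<And>s. 0 \<le> l s" "\<And>s. l s \<le> \<epsilon>"
    "\<And>s. l s = 0 \<longleftrightarrow> s \<in> A"
proof (cases "A = {}")
  case True
  show thesis by (rule that[of "\<lambda>_. \<epsilon>"]) (use True assms in auto)
next
  case False
  show thesis
  proof (rule that[of "\<lambda>s. min \<epsilon> (infdist s A)"])
    show "min \<epsilon> (infdist s A) = 0 \<longleftrightarrow> s \<in> A" for s
      using assms False by (auto simp: in_closed_iff_infdist_zero min_def)
  qed (use assms in \<open>auto simp: infdist_nonneg intro!: continuous_intros\<close>)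
qed

text \<open>The positive part of one function \<open>r a\<close> becomes the weight of colour \<open>a\<close> at \<open>v\<close>, and its negative
  part caps the weight of \<open>a\<close> at the neighbours of \<open>v\<close>; so the supports stay disjoint automatically.
  On \<open>A\<close> both parts are prescribed by \<open>f\<close>. The bump \<open>l\<close> keeps \<open>r\<close> positive somewhere off \<open>A\<close>, and the
  vanishing of \<open>x a\<close> on \<open>P a\<close> keeps \<open>r\<close> negative at some colour of each neighbour.\<close>

lemma coloring_lift:
  fixes f g :: "(nat \<Rightarrow> real) \<Rightarrow> nat \<times> nat \<Rightarrow> real"
  assumes S: "finite S" "v \<notin> S" and loop: "{v} \<notin> E" and m: "0 < m"
    and A: "compact A" and B: "compact B" and AB: "A \<subseteq> B"
    and cf: "continuous_on A f" and fX: "\<And>s. s \<in> A \<Longrightarrow> f s \<in> coloring_space E m (insert v S)"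
    and cg: "continuous_on B g" and gX: "\<And>s. s \<in> B \<Longrightarrow> g s \<in> coloring_space E m S"
    and fg: "\<And>s w a. s \<in> A \<Longrightarrow> w \<in> S \<Longrightarrow> g s (w, a) = f s (w, a)"
    and free: "\<And>s. s \<in> B \<Longrightarrow> \<exists>a<m. \<forall>w\<in>S. {w, v} \<in> E \<longrightarrow> g s (w, a) = 0"
  shows "\<exists>F. continuous_on B F \<and> (\<forall>s\<in>B. F s \<in> coloring_space E m (insert v S)) \<and> (\<forall>s\<in>A. F s = f s)"
proof -
  define N where "N = {w\<in>S. {w, v} \<in> E}"
  have finN: "finite N" using S by (simp add: N_def)
  have NS: "N \<subseteq> S" by (auto simp: N_def)
  have gP: "g s \<in> simplex_prod S m" if "s \<in> B" for s
    using gX[OF that] by (simp add: coloring_space_def)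
  have fP: "f s \<in> simplex_prod (insert v S) m" if "s \<in> A" for s
    using fX[OF that] by (simp add: coloring_space_def)
  note g0 = simplex_prodD(1)[OF gP] and f0 = simplex_prodD(1)[OF fP]
  have cgi: "continuous_on B (\<lambda>s. g s i)" for i
    using continuous_on_product_then_coordinatewise[OF cg] .
  have cfi: "continuous_on A (\<lambda>s. f s i)" for i
    using continuous_on_product_then_coordinatewise[OF cf] .
  \<comment> \<open>The total weight of colour a on the neighbours of v; it vanishes exactly when a
    is free for v.\<close>
  define M where "M = (\<lambda>a s. \<Sum>w\<in>N. g s (w, a))"
  have cM: "continuous_on B (M a)" for a
    unfolding M_def by (intro continuous_on_sum cgi)
  have gM: "g s (w, a) \<le> M a s" if "s \<in> B" "w \<in> N" for s w a
    unfolding M_def using that finN g0 by (intro member_le_sum) auto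
  have M0: "0 \<le> M a s" if "s \<in> B" for a s
    unfolding M_def using that g0 by (intro sum_nonneg) auto
  have disj: "M a s = 0 \<or> f s (v, a) = 0" if "s \<in> A" for a s
  proof (cases "f s (v, a) = 0")
    case False
    have "g s (w, a) = 0" if "w \<in> N" for w
      using fX[OF \<open>s \<in> A\<close>] False fg[OF \<open>s \<in> A\<close>] that by (auto simp: coloring_space_def N_def)
    then show ?thesis by (simp add: M_def)
  qed simp
  have closedAB: "closed A" "closed B" using A B compact_imp_closed by auto
  \<comment> \<open>The threshold comes from the pigeonhole principle: m weights with sum 1 include
    one that is at least 1 / m, so each neighbour puts s into some \<open>P a\<close>.\<close>
  define P where "P = (\<lambda>a. {s\<in>B. 1 / real m \<le> M a s})"
  have clP: "closed (P a)" for a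
    unfolding P_def by (intro continuous_on_closed_Collect_le closedAB cM continuous_on_const)
  have "\<exists>x. continuous_on B x \<and> (\<forall>s\<in>A. x s = f s (v, a)) \<and> (\<forall>s\<in>P a. x s = 0) \<and> (\<forall>s\<in>B. 0 \<le> x s)" for a
  proof -
    \<comment> \<open>The prescriptions on A and on \<open>P a\<close> agree on the overlap, where
      \<open>M a s > 0\<close> forces \<open>f s (v, a) = 0\<close>. Dugundji's theorem with the
      convex range \<open>{0..}\<close> keeps the extension nonnegative.\<close>
    define y where "y = (\<lambda>s. if s \<in> A then f s (v, a) else 0)"
    have fP0: "f s (v, a) = 0" if "s \<in> A" "s \<in> P a" for s
      using that disj[of s a] m by (auto simp: P_def)
    then have yP: "y s = 0" if "s \<in> P a" for s
      using that by (simp add: y_def)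
    have yim: "y ` (A \<union> P a) \<subseteq> {0..}"
      using f0 by (auto simp: y_def)
    have cy: "continuous_on (A \<union> P a) y"
      unfolding y_def
    proof (rule continuous_on_cases[OF closedAB(1) clP cfi continuous_on_const])
      show "\<forall>s. s \<in> A \<and> s \<notin> A \<or> s \<in> P a \<and> s \<in> A \<longrightarrow> f s (v, a) = 0"
        using fP0 by blast
    qed
    have clo: "closedin (top_of_set B) (A \<union> P a)"
      using closedAB clP AB by (intro closed_subset) (auto simp: P_def)
    obtain x where x: "continuous_on B x" "x ` B \<subseteq> {0..}" "\<And>s. s \<in> A \<union> P a \<Longrightarrow> x s = y s"
      by (rule Dugundji[OF convex_real_interval(1) _ clo cy yim]) auto
    then show ?thesis
      using yP by (intro exI[of _ x]) (auto simp: y_def image_subset_iff)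
  qed
  then obtain x where cx: "\<And>a. continuous_on B (x a)" and xA: "\<And>a s. s \<in> A \<Longrightarrow> x a s = f s (v, a)"
      and xP: "\<And>a s. s \<in> P a \<Longrightarrow> x a s = 0" and x0: "\<And>a s. s \<in> B \<Longrightarrow> 0 \<le> x a s"
    by metis
  \<comment> \<open>The bound 1 / (2m) is strictly below the threshold 1 / m, so the bump cannot
    cancel the negative part of r on \<open>P a\<close>.\<close>
  obtain l :: "(nat \<Rightarrow> real) \<Rightarrow> real" where l: "continuous_on UNIV l" "\<And>s. 0 \<le> l s" "\<And>s. l s \<le> 1 / (2 * real m)"
      "\<And>s. l s = 0 \<longleftrightarrow> s \<in> A"
    using vanishing_bump[OF closedAB(1), of "1 / (2 * real m)"] m by auto
  define r where "r = (\<lambda>a s. x a s + l s - M a s)"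
  have cr: "continuous_on B (r a)" for a
    unfolding r_def by (intro continuous_intros cx cM continuous_on_subset[OF l(1)]) auto
  have rA: "r a s = f s (v, a) - M a s" if "s \<in> A" for a s
    using that xA l(4) by (simp add: r_def)
  have rpos: "\<exists>a<m. 0 < r a s" if s: "s \<in> B" for s
  proof (cases "s \<in> A")
    case True
    have "(\<Sum>a<m. f s (v, a)) = 1" using simplex_prodD(3)[OF fP[OF True]] by simp
    then have "\<exists>a<m. f s (v, a) \<noteq> 0"
      by (metis lessThan_iff sum.neutral zero_neq_one)
    then obtain a where a: "a < m" "f s (v, a) \<noteq> 0" by blast
    then show ?thesis using rA[OF True] disj[OF True, of a] f0[OF True] by (auto simp: less_le)
  next
    case False
    obtain a where a: "a < m" "\<forall>w\<in>S. {w, v} \<in> E \<longrightarrow> g s (w, a) = 0" using free[OF s] by blast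
    then have "M a s = 0" by (auto simp: M_def N_def intro!: sum.neutral)
    moreover have "0 < l s" using False l(2,4) by (metis less_le)
    ultimately show ?thesis using a(1) x0[OF s, of a] by (auto simp: r_def)
  qed
  have rneg: "\<exists>a<m. 0 < min (g s (w, a)) (max 0 (- r a s))" if s: "s \<in> B" and w: "w \<in> N" for s w
  proof -
    have "(\<Sum>a<m. g s (w, a)) = 1" using simplex_prodD(3)[OF gP[OF s]] w NS by auto
    moreover have "(\<Sum>a<m. g s (w, a)) < (\<Sum>a<m. 1 / real m)" if "\<forall>a<m. g s (w, a) < 1 / real m"
      using that m by (intro sum_strict_mono) auto
    ultimately have "\<not> (\<forall>a<m. g s (w, a) < 1 / real m)"
      using m by auto
    then obtain a where a: "a < m" "1 / real m \<le> g s (w, a)"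
      by (auto simp: not_less)
    then have "s \<in> P a" using gM[OF s w, of a] s by (simp add: P_def)
    then have "x a s = 0" "1 / real m \<le> M a s" using xP by (auto simp: P_def)
    moreover have "1 / (2 * real m) < 1 / real m" using m by (simp add: field_simps)
    ultimately have "r a s < 0" using l(3)[of s] by (simp add: r_def)
    moreover have "0 < g s (w, a)" using a(2) m by (meson less_le_trans of_nat_0_less_iff zero_less_divide_1_iff)
    ultimately show ?thesis using a(1) by auto
  qed
  \<comment> \<open>These weights are not yet normalised. The minimum with g keeps a neighbour from
    gaining a colour, so the edges inside S stay properly coloured.\<close>
  define q where "q = (\<lambda>u a s. if u = v then max 0 (r a s) else min (g s (u, a)) (max 0 (- r a s)))"
  have cq: "continuous_on B (q u a)" for u a
  proof -
    have "continuous_on B (\<lambda>s. max 0 (r a s))" "continuous_on B (\<lambda>s. min (g s (u, a)) (max 0 (- r a s)))"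
      by (intro continuous_intros cr cgi)+
    then show ?thesis by (cases "u = v") (simp_all add: q_def)
  qed
  have q0: "0 \<le> q u a s" if "s \<in> B" for u a s
    using g0[OF that] by (simp add: q_def)
  have sq: "0 < (\<Sum>a<m. q u a s)" if s: "s \<in> B" and u: "u \<in> insert v N" for u s
  proof -
    obtain a where "a < m" "0 < q u a s"
      using u rpos[OF s] rneg[OF s, of u] NS S by (cases "u = v") (auto simp: q_def)
    then show ?thesis using q0[OF s] by (intro sum_pos2[of _ a]) auto
  qed
  \<comment> \<open>On A one of \<open>f s (v, a)\<close> and \<open>M a s\<close> is zero, so they
    are the positive and negative part of r; and M bounds the weight at each neighbour.\<close>
  have qA: "q u a s = f s (u, a)" if s: "s \<in> A" and u: "u \<in> insert v N" for u a s
  proof (cases "f s (v, a) = 0")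
    case True
    have "s \<in> B" using s AB by auto
    then show ?thesis
      using True u rA[OF s, of a] M0[of s a] gM[of s u a] fg[OF s, of u] NS S by (auto simp: q_def)
  next
    case False
    have "s \<in> B" using s AB by auto
    have M: "M a s = 0" using False disj[OF s, of a] by simp
    have "g s (u, a) = 0" if "u \<in> N"
      using M gM[OF \<open>s \<in> B\<close> that, of a] g0[OF \<open>s \<in> B\<close>] by (metis order_antisym)
    then show ?thesis
      using False M u rA[OF s, of a] f0[OF s] fg[OF s, of u a] NS S by (auto simp: q_def)
  qed
  define F where "F = (\<lambda>s i. if fst i \<in> insert v N \<and> snd i < m
    then q (fst i) (snd i) s / (\<Sum>b<m. q (fst i) b s) else g s i)"
  have F1: "F s (u, a) = q u a s / (\<Sum>b<m. q u b s)" if "u \<in> insert v N" "a < m" for s u a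
    using that by (simp add: F_def)
  have F2: "F s (u, a) = g s (u, a)" if "u \<notin> insert v N \<or> \<not> a < m" for s u a
    using that by (auto simp: F_def)
  have cF: "continuous_on B F"
  proof (rule continuous_on_coordinatewise_then_product)
    fix i
    show "continuous_on B (\<lambda>s. F s i)"
    proof (cases "fst i \<in> insert v N \<and> snd i < m")
      case True
      have "continuous_on B (\<lambda>s. q (fst i) (snd i) s / (\<Sum>b<m. q (fst i) b s))"
      proof (intro continuous_on_divide continuous_on_sum cq ballI)
        show "(\<Sum>b<m. q (fst i) b s) \<noteq> 0" if "s \<in> B" for s
          using sq[OF that, of "fst i"] True by simp
      qed
      then show ?thesis
        by (rule continuous_on_eq) (use True in \<open>simp add: F_def\<close>)
    next
      case False
      then show ?thesis
        by (intro continuous_on_eq[OF cgi[of i]]) (auto simp: F_def)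
    qed
  qed
  have F0: "F s (u, a) = 0" if "g s (u, a) = 0" "s \<in> B" "u \<noteq> v" for s u a
    using that by (cases "u \<in> insert v N \<and> a < m") (auto simp: F1 F2 q_def)
  have gv: "g s (v, a) = 0" if "s \<in> B" for s a
    using simplex_prodD(2)[OF gP[OF that]] S by simp
  have FP: "F s \<in> simplex_prod (insert v S) m" if s: "s \<in> B" for s
    unfolding simplex_prod_def
  proof (intro CollectI conjI allI ballI impI)
    show "0 \<le> F s i" for i
      using q0[OF s] g0[OF s] by (cases i) (auto simp: F_def intro!: divide_nonneg_nonneg sum_nonneg)
    show "F s i = 0" if "i \<notin> insert v S \<times> {..<m}" for i
    proof -
      have "\<not> (fst i \<in> insert v N \<and> snd i < m)" using that NS by (cases i) auto
      then have "F s i = g s i" by (auto simp: F_def)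
      then show ?thesis using simplex_prodD(2)[OF gP[OF s], of i] that by auto
    qed
    show "(\<Sum>a<m. F s (u, a)) = 1" if u: "u \<in> insert v S" for u
    proof (cases "u \<in> insert v N")
      case True
      then have "(\<Sum>a<m. F s (u, a)) = (\<Sum>a<m. q u a s) / (\<Sum>b<m. q u b s)"
        by (simp add: F1 flip: sum_divide_distrib)
      then show ?thesis using sq[OF s True] by simp
    next
      case False
      then show ?thesis using u simplex_prodD(3)[OF gP[OF s], of u] by (simp add: F2)
    qed
  qed
  have opp: "F s (v, a) = 0 \<or> F s (w, a) = 0" if s: "s \<in> B" and w: "w \<in> S" "{w, v} \<in> E" for s w a
  proof (cases "a < m")
    case True
    have "w \<in> N" "w \<noteq> v" using w S by (auto simp: N_def)
    then show ?thesis using True g0[OF s, of "(w, a)"] by (auto simp: F1 q_def)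
  qed (simp add: F2 gv[OF s])
  have FX: "F s \<in> coloring_space E m (insert v S)" if s: "s \<in> B" for s
    unfolding coloring_space_def
  proof (intro CollectI conjI ballI impI allI FP[OF s])
    fix u w a assume uw: "u \<in> insert v S" "w \<in> insert v S" "{u, w} \<in> E"
    consider "u = v" "w = v" | "u = v" "w \<in> S" | "w = v" "u \<in> S" | "u \<in> S" "w \<in> S" "u \<noteq> v" "w \<noteq> v"
      using uw by blast
    then show "F s (u, a) = 0 \<or> F s (w, a) = 0"
    proof cases
      case 1 then show ?thesis using uw loop by simp
    next
      case 2 then show ?thesis using opp[OF s, of w a] uw by (simp add: insert_commute)
    next
      case 3 then show ?thesis using opp[OF s, of u a] uw by auto
    next
      case 4
      then have "g s (u, a) = 0 \<or> g s (w, a) = 0"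
        using gX[OF s] uw by (simp add: coloring_space_def)
      then show ?thesis using F0[OF _ s] 4 by blast
    qed
  qed
  have FA: "F s = f s" if s: "s \<in> A" for s
  proof
    fix i :: "nat \<times> nat"
    obtain u a where i: "i = (u, a)" by (cases i)
    have sB: "s \<in> B" using s AB by auto
    show "F s i = f s i"
    proof (cases "u \<in> insert v N \<and> a < m")
      case True
      have "u \<in> insert v S" using True NS by auto
      \<comment> \<open>On A the weights q are those of f, so normalising changes nothing.\<close>
      then have "(\<Sum>b<m. q u b s) = 1"
        using simplex_prodD(3)[OF fP[OF s], of u] qA[OF s, of u] True by simp
      then show ?thesis using True qA[OF s, of u a] by (simp add: i F1)
    next
      case False
      then have Fg: "F s i = g s i" by (auto simp: i F2)
      show ?thesis
      proof (cases "u \<in> S")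
        case True
        then show ?thesis using Fg fg[OF s] by (simp add: i)
      next
        case out: False
        then have "i \<notin> insert v S \<times> {..<m}" "i \<notin> S \<times> {..<m}" using False by (auto simp: i)
        then show ?thesis
          using Fg simplex_prodD(2)[OF gP[OF sB]] simplex_prodD(2)[OF fP[OF s]] by simp
      qed
    qed
  qed
  show ?thesis using cF FX FA by blast
qed

text \<open>\<eta> contains m pairs over N, one for each colour, and one pair over each vertex of S
  - N; the two families are disjoint.\<close>

lemma card_bad_cell:
  assumes \<eta>: "finite \<eta>" "\<eta> \<subseteq> S \<times> UNIV" and S: "finite S" "N \<subseteq> S"
    and ne: "\<And>w. w \<in> S \<Longrightarrow> \<exists>a. (w, a) \<in> \<eta>"
    and cover: "\<And>a. a < m \<Longrightarrow> \<exists>w\<in>N. (w, a) \<in> \<eta>"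
  shows "m + card S \<le> card \<eta> + card N"
proof -
  obtain \<alpha> where \<alpha>: "\<And>w. w \<in> S \<Longrightarrow> (w, \<alpha> w) \<in> \<eta>" using ne by metis
  obtain \<beta> where \<beta>: "\<And>a. a < m \<Longrightarrow> \<beta> a \<in> N \<and> (\<beta> a, a) \<in> \<eta>" using cover by metis
  let ?J = "(\<lambda>a. (\<beta> a, a)) ` {..<m}" and ?K = "(\<lambda>w. (w, \<alpha> w)) ` (S - N)"
  have "card (?J \<union> ?K) = card ?J + card ?K"
    using S \<beta> by (intro card_Un_disjoint) auto
  also have "card ?J = m" by (simp add: card_image inj_on_def)
  also have "card ?K = card S - card N"
    using S by (simp add: card_image inj_on_def card_Diff_subset finite_subset)
  finally have "m + (card S - card N) \<le> card \<eta>"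
    using card_mono[OF \<eta>(1), of "?J \<union> ?K"] \<alpha> \<beta> by auto
  then show ?thesis by linarith
qed

text \<open>Allowing arbitrary compact pairs makes the induction go through and later yields both
  nonemptiness and null-homotopies.\<close>

lemma coloring_space_extension:
  fixes f :: "(nat \<Rightarrow> real) \<Rightarrow> nat \<times> nat \<Rightarrow> real"
  assumes "finite S" and loop: "\<And>v. {v} \<notin> E"
    and degen: "\<And>T. T \<subseteq> S \<Longrightarrow> T \<noteq> {} \<Longrightarrow> \<exists>v\<in>T. card {u\<in>T. {u, v} \<in> E} \<le> k"
    and pk: "p + k < m"
    and A: "compact A" and B: "compact B" and AB: "A \<subseteq> B" "B \<subseteq> coord_space p"
    and "continuous_on A f" "\<And>s. s \<in> A \<Longrightarrow> f s \<in> coloring_space E m S"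
  shows "\<exists>F. continuous_on B F \<and> (\<forall>s\<in>B. F s \<in> coloring_space E m S) \<and> (\<forall>s\<in>A. F s = f s)"
  using assms(1) degen assms(9,10)
proof (induction "card S" arbitrary: S f)
  case 0
  then have "S = {}" by simp
  then have "f s = (\<lambda>_. 0)" if "s \<in> A" for s
    using 0(5)[OF that] by (auto simp: coloring_space_def simplex_prod_def)
  then show ?case
    using \<open>S = {}\<close> by (intro exI[of _ "\<lambda>_ _. 0"]) (auto simp: coloring_space_def simplex_prod_def)
next
  case (Suc n)
  have "S \<noteq> {}" using Suc.hyps(2) by auto
  then obtain v where v: "v \<in> S" "card {u\<in>S. {u, v} \<in> E} \<le> k"
    using Suc.prems(2)[of S] by blast
  define S' where "S' = S - {v}"
  have S': "S = insert v S'" "v \<notin> S'" "finite S'" "S' \<subseteq> S" using v Suc.prems(1) by (auto simp: S'_def)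
  have n: "n = card S'" using Suc.hyps(2) S' by simp
  define N where "N = {w\<in>S'. {w, v} \<in> E}"
  have "card N \<le> card {u\<in>S. {u, v} \<in> E}"
    using Suc.prems(1) by (intro card_mono) (auto simp: N_def S'_def)
  then have cardN: "card N \<le> k" using v by simp
  have fX: "f s \<in> coloring_space E m (insert v S')" if "s \<in> A" for s
    using Suc.prems(4)[OF that] S'(1) by simp
  have fP: "f s \<in> simplex_prod S m" if "s \<in> A" for s
    using Suc.prems(4)[OF that] by (simp add: coloring_space_def)
  \<comment> \<open>The restriction of f to the graph without v.\<close>
  define f' where "f' = (\<lambda>s i. if fst i = v then 0 else f s i)"
  have f'eq: "f' s (w, a) = f s (w, a)" if "w \<in> S'" for s w a
    using that S' by (auto simp: f'_def)
  have cf': "continuous_on A f'"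
    unfolding f'_def
  proof (rule continuous_on_coordinatewise_then_product)
    show "continuous_on A (\<lambda>s. if fst i = v then 0 else f s i)" for i
      using continuous_on_product_then_coordinatewise[OF Suc.prems(3)] by (cases "fst i = v") auto
  qed
  have f'P: "f' s \<in> simplex_prod S' m" if s: "s \<in> A" for s
    unfolding simplex_prod_def
  proof (intro CollectI conjI allI impI ballI)
    show "0 \<le> f' s i" for i using simplex_prodD(1)[OF fP[OF s]] by (simp add: f'_def)
    show "f' s i = 0" if "i \<notin> S' \<times> {..<m}" for i
    proof (cases "fst i = v")
      case False
      then have "i \<notin> S \<times> {..<m}" using that by (cases i) (auto simp: S'_def)
      then show ?thesis using simplex_prodD(2)[OF fP[OF s]] by (simp add: f'_def)
    qed (simp add: f'_def)
    show "(\<Sum>a<m. f' s (w, a)) = 1" if "w \<in> S'" for w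
      using simplex_prodD(3)[OF fP[OF s], of w] that S'(4) by (auto simp: f'eq)
  qed
  have f'X: "f' s \<in> coloring_space E m S'" if s: "s \<in> A" for s
    using f'P[OF s] Suc.prems(4)[OF s] S'(4) by (auto simp: coloring_space_def f'eq)
  have "\<exists>g. continuous_on B g \<and> (\<forall>s\<in>B. g s \<in> coloring_space E m S') \<and> (\<forall>s\<in>A. g s = f' s)"
  proof (rule Suc.hyps(1)[OF n S'(3) _ cf' f'X])
    show "\<exists>v\<in>T. card {u \<in> T. {u, v} \<in> E} \<le> k" if "T \<subseteq> S'" "T \<noteq> {}" for T
      using Suc.prems(2)[of T] that S'(4) by auto
  qed
  then obtain g where g: "continuous_on B g" "\<And>s. s \<in> B \<Longrightarrow> g s \<in> coloring_space E m S'" "\<And>s. s \<in> A \<Longrightarrow> g s = f' s"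
    by blast
  have gP: "g s \<in> simplex_prod S' m" if "s \<in> B" for s
    using g(2)[OF that] by (simp add: coloring_space_def)
  \<comment> \<open>The cells on which the neighbours of v leave no colour free. At most k
    neighbours give them dimension at least m - k > p.\<close>
  define bad where "bad = {\<eta>. \<eta> \<subseteq> S' \<times> {..<m} \<and> (\<forall>w\<in>S'. \<exists>a. (w, a) \<in> \<eta>) \<and> (\<forall>a<m. \<exists>w\<in>N. (w, a) \<in> \<eta>)}"
  have dim: "p + card S' < card \<eta>" if "\<eta> \<in> bad" for \<eta>
  proof -
    have "m + card S' \<le> card \<eta> + card N"
      using that S'(3) by (intro card_bad_cell) (auto simp: bad_def N_def intro: finite_subset[of _ "S' \<times> {..<m}"])
    then show ?thesis using cardN pk by linarith
  qed
  have "\<exists>g'. continuous_on B g' \<and> (\<forall>s\<in>B. g' s \<in> simplex_prod S' m \<and> supp (g' s) \<subseteq> supp (g s) \<and>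
    supp (g' s) \<notin> bad \<and> (supp (g s) \<notin> bad \<longrightarrow> g' s = g s))"
  proof (rule push_off_cells[OF S'(3) _ _ dim B AB(2) g(1) gP])
    show "bad \<subseteq> Pow (S' \<times> {..<m})" by (auto simp: bad_def)
    show "\<eta>' \<in> bad" if "\<eta> \<in> bad" "\<eta> \<subseteq> \<eta>'" "\<eta>' \<subseteq> S' \<times> {..<m}" for \<eta> \<eta>'
      using that unfolding bad_def by blast
  qed
  then obtain h where ch: "continuous_on B h" and hP: "\<And>s. s \<in> B \<Longrightarrow> h s \<in> simplex_prod S' m"
    and hle: "\<And>s. s \<in> B \<Longrightarrow> supp (h s) \<subseteq> supp (g s)" and hbad: "\<And>s. s \<in> B \<Longrightarrow> supp (h s) \<notin> bad"
    and heq: "\<And>s. s \<in> B \<Longrightarrow> supp (g s) \<notin> bad \<Longrightarrow> h s = g s"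
    by blast
  have hX: "h s \<in> coloring_space E m S'" if s: "s \<in> B" for s
    unfolding coloring_space_def
  proof (intro CollectI conjI ballI impI allI hP[OF s])
    fix u w a assume "u \<in> S'" "w \<in> S'" "{u, w} \<in> E"
    then have "g s (u, a) = 0 \<or> g s (w, a) = 0" using g(2)[OF s] by (simp add: coloring_space_def)
    then show "h s (u, a) = 0 \<or> h s (w, a) = 0" using hle[OF s] by (auto simp: supp_def)
  qed
  have free: "\<exists>a<m. \<forall>w\<in>S'. {w, v} \<in> E \<longrightarrow> h s (w, a) = 0" if s: "s \<in> B" for s
  proof -
    have "\<exists>a. (w, a) \<in> supp (h s)" if "w \<in> S'" for w
    proof (rule ccontr)
      assume "\<not> ?thesis"
      then have "(\<Sum>a<m. h s (w, a)) = 0" by (auto simp: supp_def)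
      then show False using simplex_prodD(3)[OF hP[OF s] that] by simp
    qed
    then have "\<exists>a<m. \<forall>w\<in>N. (w, a) \<notin> supp (h s)"
      using hbad[OF s] supp_simplex_prod[OF hP[OF s]] unfolding bad_def by blast
    then show ?thesis by (auto simp: N_def supp_def)
  qed
  \<comment> \<open>On A a colour that f uses at v is absent from all neighbours, so no bad cell
    occurs and the push leaves these points alone.\<close>
  have hf: "h s (w, a) = f s (w, a)" if s: "s \<in> A" and w: "w \<in> S'" for s w a
  proof -
    have "(\<Sum>a<m. f s (v, a)) = 1" using simplex_prodD(3)[OF fP[OF s] v(1)] .
    then obtain b where b: "b < m" "f s (v, b) \<noteq> 0"
      by (metis lessThan_iff sum.neutral zero_neq_one)
    have "g s (u, b) = 0" if "u \<in> N" for u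
    proof -
      have "f s (u, b) = 0 \<or> f s (v, b) = 0"
        using Suc.prems(4)[OF s] that v(1) S'(4) by (auto simp: coloring_space_def N_def)
      then show ?thesis using b that g(3)[OF s] by (auto simp: f'eq N_def)
    qed
    then have "supp (g s) \<notin> bad" using b(1) by (auto simp: bad_def supp_def)
    then have "h s = f' s" using heq g(3)[OF s] s AB(1) by auto
    then show ?thesis using w by (simp add: f'eq)
  qed
  have "0 < m" using pk by simp
  show ?case
    unfolding S'(1)
    by (rule coloring_lift[OF S'(3,2) loop \<open>0 < m\<close> A B AB(1) Suc.prems(3) fX ch hX hf free])
qed

subsection \<open>Connectivity\<close>

lemma hom_space_eq:
  assumes "E \<subseteq> all_edges n"
  shows "hom_space n E m (all_edges m) = top_of_set (coloring_space E m {..<n})"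
proof -
  have "(\<Union>\<eta>\<in>hom_cells n E m (all_edges m). cell_realization n \<eta>) = coloring_space E m {..<n}" (is "?L = ?R")
  proof (intro equalityI subsetI)
    fix x assume "x \<in> ?L"
    then obtain \<eta> where \<eta>: "\<eta> \<in> hom_cells n E m (all_edges m)" and x: "x \<in> cell_realization n \<eta>" by blast
    have \<eta>v: "\<eta> v \<subseteq> {..<m}" if "v < n" for v using \<eta> that by (auto simp: hom_cells_def)
    have x0: "x (v, w) = 0" if "w \<notin> \<eta> v" for v w using x that by (auto simp: cell_realization_def)
    have "(\<Sum>a<m. x (v, a)) = 1" if "v < n" for v
    proof -
      have "(\<Sum>a<m. x (v, a)) = (\<Sum>a\<in>\<eta> v. x (v, a))"
        using \<eta>v[OF that] x0 by (intro sum.mono_neutral_right) auto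
      then show ?thesis using x that by (auto simp: cell_realization_def)
    qed
    moreover have "x (v, a) = 0" if "\<not> (v < n \<and> a < m)" for v a
    proof (rule x0, cases "v < n")
      case True
      then show "a \<notin> \<eta> v" using that \<eta>v[OF True] by auto
    next
      case False
      then have "\<eta> v = {}" using \<eta> by (simp add: hom_cells_def)
      then show "a \<notin> \<eta> v" by simp
    qed
    moreover have "x (u, a) = 0 \<or> x (v, a) = 0" if "{u, v} \<in> E" for u v a
    proof (rule ccontr)
      assume "\<not> ?thesis"
      then have "a \<in> \<eta> u" "a \<in> \<eta> v" using x0 by blast+
      moreover have "\<forall>a\<in>\<eta> u. \<forall>b\<in>\<eta> v. {a, b} \<in> all_edges m"
        using \<eta> that by (simp add: hom_cells_def)
      \<comment> \<open>A shared colour would be a loop of the complete graph.\<close>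
      ultimately have "{a, a} \<in> all_edges m" by blast
      then show False by (auto simp: all_edges_def doubleton_eq_iff)
    qed
    ultimately show "x \<in> ?R"
      using x by (auto simp: coloring_space_def simplex_prod_def cell_realization_def)
  next
    fix x assume x: "x \<in> ?R"
    then have xP: "x \<in> simplex_prod {..<n} m" by (simp add: coloring_space_def)
    \<comment> \<open>The support of x, read as a multihomomorphism, is the smallest cell containing
      x.\<close>
    define \<eta> where "\<eta> = (\<lambda>v. {a. x (v, a) \<noteq> 0})"
    have x0: "x (v, a) = 0" if "\<not> (v < n \<and> a < m)" for v a
      using simplex_prodD(2)[OF xP] that by auto
    have \<eta>v: "\<eta> v \<subseteq> {..<m}" for v
      using x0 by (force simp: \<eta>_def)
    have sum1: "(\<Sum>a\<in>\<eta> v. x (v, a)) = 1" if "v < n" for v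
    proof -
      have "(\<Sum>a\<in>\<eta> v. x (v, a)) = (\<Sum>a<m. x (v, a))"
        using \<eta>v by (intro sum.mono_neutral_left) (auto simp: \<eta>_def)
      then show ?thesis using simplex_prodD(3)[OF xP] that by simp
    qed
    have "x \<in> cell_realization n \<eta>"
      using sum1 simplex_prodD(1)[OF xP] by (auto simp: cell_realization_def \<eta>_def)
    moreover have "\<eta> \<in> hom_cells n E m (all_edges m)"
      unfolding hom_cells_def
    proof (intro CollectI conjI allI impI ballI)
      show "\<eta> v \<noteq> {}" if "v < n" for v using sum1[OF that] by auto
      show "\<eta> v = {}" if "n \<le> v" for v using x0 that by (auto simp: \<eta>_def)
      fix u v a b assume uv: "{u, v} \<in> E" and ab: "a \<in> \<eta> u" "b \<in> \<eta> v"
      have "u < n" "v < n" using ab x0 by (auto simp: \<eta>_def)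
      then have "x (u, a) = 0 \<or> x (v, a) = 0" using x uv by (auto simp: coloring_space_def)
      then have "a \<noteq> b" using ab by (auto simp: \<eta>_def)
      then show "{a, b} \<in> all_edges m" using ab \<eta>v by (auto simp: all_edges_def)
    qed (use \<eta>v in auto)
    ultimately show "x \<in> ?L" by blast
  qed
  then show ?thesis by (simp add: hom_space_def euclidean_product_topology)
qed

text \<open>The underlying set of \<open>nsphere i\<close>. The indices j \<le> i are i + 1
  coordinates, so the ball it bounds lies in \<open>coord_space (Suc i)\<close>.\<close>

definition sphere_set :: "nat \<Rightarrow> (nat \<Rightarrow> real) set" where
  "sphere_set i = {x. (\<Sum>j\<le>i. x j ^ 2) = 1 \<and> (\<forall>j>i. x j = 0)}"

definition ball_set :: "nat \<Rightarrow> (nat \<Rightarrow> real) set" where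
  "ball_set i = {x. (\<Sum>j\<le>i. x j ^ 2) \<le> 1 \<and> (\<forall>j>i. x j = 0)}"

lemma nsphere_eq: "nsphere i = top_of_set (sphere_set i)"
  by (simp add: nsphere sphere_set_def euclidean_product_topology)

text \<open>Both are closed subsets of a product of intervals [-1, 1], which is compact by
  Tychonoff's theorem.\<close>

lemma compact_sphere_ball: "compact (sphere_set i)" "compact (ball_set i)"
proof -
  have "compact (PiE UNIV (\<lambda>_::nat. {-1..1::real}))"
  proof -
    have "compactin (product_topology (\<lambda>_. euclidean) UNIV) (PiE UNIV (\<lambda>_::nat. {-1..1::real}))"
      by (simp add: compactin_PiE)
    then show ?thesis by (simp add: euclidean_product_topology)
  qed
  moreover have sub: "ball_set i \<subseteq> PiE UNIV (\<lambda>_::nat. {-1..1::real})"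
  proof
    fix x assume x: "x \<in> ball_set i"
    have "x j \<in> {-1..1}" for j
    proof (cases "j \<le> i")
      case True
      then have "x j ^ 2 \<le> (\<Sum>j\<le>i. x j ^ 2)" by (intro member_le_sum) auto
      then have "x j ^ 2 \<le> 1" using x by (auto simp: ball_set_def)
      then show ?thesis by (simp add: abs_square_le_1 abs_le_iff)
    qed (use x in \<open>auto simp: ball_set_def\<close>)
    then show "x \<in> PiE UNIV (\<lambda>_. {-1..1})" by auto
  qed
  moreover have tail: "{x::nat \<Rightarrow> real. \<forall>j>i. x j = 0} = (\<Inter>j\<in>{i<..}. {x. x j = 0})" by auto
  have cl0: "closed {x::nat \<Rightarrow> real. \<forall>j>i. x j = 0}"
    unfolding tail
    by (intro closed_INT ballI closed_Collect_eq continuous_on_coordinate continuous_on_const)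
  have cs: "continuous_on UNIV (\<lambda>x::nat \<Rightarrow> real. \<Sum>j\<le>i. x j ^ 2)"
    by (intro continuous_intros continuous_on_coordinate)
  have "closed (ball_set i)"
    unfolding ball_set_def Collect_conj_eq
    by (intro closed_Int cl0 closed_Collect_le cs continuous_on_const)
  ultimately show b: "compact (ball_set i)"
    by (metis compact_Int_closed inf.absorb_iff2)
  have "closed (sphere_set i)"
    unfolding sphere_set_def Collect_conj_eq
    by (intro closed_Int cl0 closed_Collect_eq cs continuous_on_const)
  moreover have "sphere_set i \<subseteq> ball_set i" by (auto simp: sphere_set_def ball_set_def)
  ultimately show "compact (sphere_set i)"
    using b by (metis compact_Int_closed inf.absorb_iff2)
qed

text \<open>Shrinking the sphere radially to the centre of the ball and applying F gives the
  homotopy.\<close>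

lemma null_homotopic_of_extension:
  fixes f F :: "(nat \<Rightarrow> real) \<Rightarrow> 'b::topological_space"
  assumes cF: "continuous_on (ball_set i) F" and FX: "F \<in> ball_set i \<rightarrow> X"
    and Ff: "\<And>s. s \<in> sphere_set i \<Longrightarrow> F s = f s"
  shows "\<exists>c. homotopic_with (\<lambda>_. True) (nsphere i) (top_of_set X) f (\<lambda>_. c)"
proof -
  define h where "h = (\<lambda>(t::real, x::nat \<Rightarrow> real). F (\<lambda>j. (1 - t) * x j))"
  let ?c = "\<lambda>(t::real, x::nat \<Rightarrow> real). (\<lambda>j. (1 - t) * x j)"
  have im: "?c ` ({0..1} \<times> sphere_set i) \<subseteq> ball_set i"
  proof clarify
    fix t :: real and x assume t: "t \<in> {0..1}" and x: "x \<in> sphere_set i"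
    have "(\<Sum>j\<le>i. ((1 - t) * x j) ^ 2) = (1 - t) ^ 2"
      using x by (simp add: power_mult_distrib sphere_set_def flip: sum_distrib_left)
    also have "\<dots> \<le> 1" using t by (simp add: abs_square_le_1)
    finally show "(\<lambda>j. (1 - t) * x j) \<in> ball_set i"
      using x by (auto simp: ball_set_def sphere_set_def)
  qed
  have cc: "continuous_on ({0..1} \<times> sphere_set i) ?c"
    unfolding case_prod_unfold
  proof (rule continuous_on_coordinatewise_then_product)
    show "continuous_on ({0..1} \<times> sphere_set i) (\<lambda>z. (1 - fst z) * snd z j)" for j
      by (intro continuous_intros continuous_on_compose2[OF continuous_on_coordinate[of UNIV]]) auto
  qed
  have "homotopic_with (\<lambda>_. True) (nsphere i) (top_of_set X) f (\<lambda>_. F (\<lambda>_. 0))"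
    unfolding homotopic_with_def
  \<comment> \<open>At t = 0 the homotopy must equal f at every point of the type, even off the
    sphere, where F need not agree with f; hence the case distinction.\<close>
  proof (intro exI[of _ "\<lambda>(t, x). if t = 0 then f x else h (t, x)"] conjI allI ballI)
    have h_eq: "(case z of (t, x) \<Rightarrow> if t = 0 then f x else h (t, x)) = F (?c z)"
      if "z \<in> {0..1} \<times> sphere_set i" for z :: "real \<times> (nat \<Rightarrow> real)"
      using that Ff by (auto simp: h_def split: prod.splits)
    have "continuous_on ({0..1} \<times> sphere_set i) (\<lambda>z. F (?c z))"
      by (rule continuous_on_compose2[OF cF cc im])
    then have "continuous_on ({0..1} \<times> sphere_set i) (\<lambda>(t, x). if t = 0 then f x else h (t, x))"
      by (rule continuous_on_eq) (use h_eq in auto)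
    moreover have "(\<lambda>(t, x). if t = 0 then f x else h (t, x)) \<in> {0..1} \<times> sphere_set i \<rightarrow> X"
    proof
      fix z :: "real \<times> (nat \<Rightarrow> real)" assume z: "z \<in> {0..1} \<times> sphere_set i"
      then have "F (?c z) \<in> X" using FX im by blast
      then show "(case z of (t, x) \<Rightarrow> if t = 0 then f x else h (t, x)) \<in> X" using h_eq[OF z] by simp
    qed
    ultimately show "continuous_map (prod_topology (top_of_set {0..1}) (nsphere i)) (top_of_set X)
       (\<lambda>(t, x). if t = 0 then f x else h (t, x))"
      by (simp add: nsphere_eq prod_topology_subtopology_eu continuous_map_in_subtopology image_subset_iff_funcset)
  qed (auto simp: h_def)
  then show ?thesis by blast
qed

section \<open>From degeneracy to the connectivity bound\<close>

lemma low_degree_vertex: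
  assumes "degen n E \<le> k" "T \<subseteq> {..<n}" "T \<noteq> {}"
  shows "\<exists>v\<in>T. card {u\<in>T. {u, v} \<in> E} \<le> k"
proof -
  have fT: "finite T" using assms(2) finite_subset by blast
  have "finite {Min (induced_degree E S ` S) | S. S \<subseteq> {..<n} \<and> S \<noteq> {}}"
    by (rule finite_subset[of _ "(\<lambda>S. Min (induced_degree E S ` S)) ` Pow {..<n}"]) auto
  then have "Min (induced_degree E T ` T) \<le> degen n E"
    unfolding degen_def using assms(2,3) by (intro Max_ge) auto
  moreover have "Min (induced_degree E T ` T) \<in> induced_degree E T ` T"
    using fT assms(3) by (intro Min_in) auto
  then obtain v where v: "v \<in> T" "Min (induced_degree E T ` T) = induced_degree E T v"
    by blast
  ultimately have "induced_degree E T v \<le> k" using assms(1) by simp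
  then show ?thesis using v(1) by (auto simp: induced_degree_def)
qed

text \<open>A map on the i-sphere is extended over a ball of dimension i + 1, which requires
  \<open>Suc i + k < m\<close>, that is, i \<le> m - k - 2.\<close>

lemma j_connected_hom_space:
  assumes E: "E \<subseteq> all_edges n" and dg: "degen n E \<le> k"
  shows "j_connected (int m - int k - 2) (hom_space n E m (all_edges m))"
proof -
  let ?X = "coloring_space E m {..<n}"
  have loop: "{v} \<notin> E" for v using E by (auto simp: all_edges_def)
  have ext: "\<exists>F. continuous_on B F \<and> (\<forall>s\<in>B. F s \<in> ?X) \<and> (\<forall>s\<in>A. F s = f s)"
    if "p + k < m" "compact A" "compact B" "A \<subseteq> B" "B \<subseteq> coord_space p" "continuous_on A f"
      "\<And>s. s \<in> A \<Longrightarrow> f s \<in> ?X" for p A B f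
    by (rule coloring_space_extension[OF finite_lessThan loop _ that])
      (use low_degree_vertex[OF dg] in \<open>auto simp: subset_iff\<close>)
  \<comment> \<open>Extending the empty map to a one-point space, with p = 0, produces a
    point.\<close>
  have "?X \<noteq> {}" if "0 + k < m"
    using ext[OF that, of "{}" "{\<lambda>_. 0}" "\<lambda>_ _. 0"] by (auto simp: coord_space_def)
  moreover have "\<exists>c. homotopic_with (\<lambda>_. True) (nsphere i) (top_of_set ?X) f (\<lambda>_. c)"
    if "Suc i + k < m" and f: "continuous_map (nsphere i) (top_of_set ?X) f" for i f
  proof -
    have fX: "f s \<in> ?X" if "s \<in> sphere_set i" for s
      using f that by (auto simp: nsphere_eq continuous_map_in_subtopology)
    have "continuous_on (sphere_set i) f"
      using f by (auto simp: nsphere_eq continuous_map_in_subtopology)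
    moreover have "sphere_set i \<subseteq> ball_set i" "ball_set i \<subseteq> coord_space (Suc i)"
      by (auto simp: sphere_set_def ball_set_def coord_space_def)
    ultimately have "\<exists>F. continuous_on (ball_set i) F \<and> (\<forall>s\<in>ball_set i. F s \<in> ?X) \<and> (\<forall>s\<in>sphere_set i. F s = f s)"
      using fX by (intro ext[OF that(1) compact_sphere_ball]) auto
    then obtain F where "continuous_on (ball_set i) F" "\<forall>s\<in>ball_set i. F s \<in> ?X" "\<forall>s\<in>sphere_set i. F s = f s"
      by blast
    then show ?thesis by (intro null_homotopic_of_extension[of i F]) auto
  qed
  ultimately show ?thesis
    unfolding j_connected_def hom_space_eq[OF E] by auto
qed

lemma M_conn_ge:
  assumes "E \<subseteq> all_edges n" "degen n E \<le> k"
  shows "ereal (real_of_int (int m - int k - 2)) \<le> M_conn n E m"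
  unfolding M_conn_def conn_def
  using j_connected_hom_space[OF assms] by (intro Sup_upper) blast

subsection \<open>Random graphs\<close>

text \<open>Arbitrary edge sets A and real-valued f allow induction on A one edge at a time.\<close>

definition gnp_expectation :: "'e set \<Rightarrow> real \<Rightarrow> ('e set \<Rightarrow> real) \<Rightarrow> real" where
  "gnp_expectation A p f = (\<Sum>E\<in>Pow A. f E * (p ^ card E * (1 - p) ^ (card A - card E)))"

lemma prob_gnp_eq: "prob_gnp n p P = gnp_expectation (all_edges n) p (\<lambda>E. of_bool (P E))"
  unfolding prob_gnp_def gnp_expectation_def by (intro sum.cong) auto

lemma finite_all_edges: "finite (all_edges n)"
  by (rule finite_subset[of _ "Pow {..<n}"]) (auto simp: all_edges_def)

text \<open>Conditioning on the absence or presence of e.\<close>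

lemma gnp_expectation_insert:
  assumes "finite A" "e \<notin> A"
  shows "gnp_expectation (insert e A) p f =
    (1 - p) * gnp_expectation A p f + p * gnp_expectation A p (\<lambda>E. f (insert e E))"
proof -
  let ?w = "\<lambda>E. p ^ card E * (1 - p) ^ (card (insert e A) - card E)"
  have finE: "finite E" "e \<notin> E" "card E \<le> card A" if "E \<in> Pow A" for E
    using that assms by (auto intro: finite_subset card_mono)
  have inj: "inj_on (insert e) (Pow A)"
    using assms by (auto simp: inj_on_def)
  have "gnp_expectation (insert e A) p f = (\<Sum>E\<in>Pow A. f E * ?w E) + (\<Sum>E\<in>insert e ` Pow A. f E * ?w E)"
    unfolding gnp_expectation_def Pow_insert using assms by (intro sum.union_disjoint) auto
  also have "(\<Sum>E\<in>insert e ` Pow A. f E * ?w E) = (\<Sum>E\<in>Pow A. f (insert e E) * ?w (insert e E))"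
    by (simp add: sum.reindex[OF inj])
  also have "\<dots> = p * gnp_expectation A p (\<lambda>E. f (insert e E))"
    unfolding gnp_expectation_def sum_distrib_left
    using assms finE by (intro sum.cong) auto
  also have "(\<Sum>E\<in>Pow A. f E * ?w E) = (1 - p) * gnp_expectation A p f"
    unfolding gnp_expectation_def sum_distrib_left
    using assms finE by (intro sum.cong) (auto simp: Suc_diff_le)
  finally show ?thesis .
qed

lemma gnp_expectation_const: "finite A \<Longrightarrow> gnp_expectation A p (\<lambda>_. c) = c"
proof (induction A rule: finite_induct)
  case empty
  then show ?case by (simp add: gnp_expectation_def)
next
  case (insert e A)
  then show ?case by (simp add: gnp_expectation_insert algebra_simps)
qed

lemma gnp_expectation_mono:
  assumes "0 \<le> p" "p \<le> 1" "\<And>E. E \<subseteq> A \<Longrightarrow> f E \<le> g E"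
  shows "gnp_expectation A p f \<le> gnp_expectation A p g"
  unfolding gnp_expectation_def using assms by (intro sum_mono mult_right_mono) auto

text \<open>By induction on the edges: raising the probability of e moves weight to the case where e
  is present, in which an increasing f has the larger mean.\<close>

lemma gnp_expectation_mono_prob:
  assumes "finite A" "0 \<le> p" "p \<le> q" "q \<le> 1" "\<And>E E'. E \<subseteq> E' \<Longrightarrow> E' \<subseteq> A \<Longrightarrow> f E \<le> f E'"
  shows "gnp_expectation A p f \<le> gnp_expectation A q f"
  using assms(1,5)
proof (induction A arbitrary: f rule: finite_induct)
  case empty
  then show ?case by (simp add: gnp_expectation_def)
next
  case (insert e A)
  let ?f = "\<lambda>E. f (insert e E)"
  have 1: "gnp_expectation A p f \<le> gnp_expectation A q f"
    by (rule insert.IH) (meson insert.prems subset_insertI2)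
  have 2: "gnp_expectation A p ?f \<le> gnp_expectation A q ?f"
    by (rule insert.IH, rule insert.prems) auto
  have 3: "gnp_expectation A q f \<le> gnp_expectation A q ?f"
    using assms(2-4) by (intro gnp_expectation_mono insert.prems) auto
  have "(1 - p) * gnp_expectation A p f + p * gnp_expectation A p ?f
    \<le> (1 - p) * gnp_expectation A q f + p * gnp_expectation A q ?f"
    using 1 2 assms(2-4) by (intro add_mono mult_left_mono) auto
  \<comment> \<open>The difference of the two sides is q - p times the gain from adding e.\<close>
  also have "\<dots> \<le> (1 - q) * gnp_expectation A q f + q * gnp_expectation A q ?f"
    using mult_right_mono[OF assms(3), of "gnp_expectation A q ?f - gnp_expectation A q f"] 3
    by (simp add: algebra_simps)
  finally show ?case using insert.hyps by (simp add: gnp_expectation_insert)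
qed

section \<open>Degeneracy and monotonicity in the edge probability\<close>

lemma degen_mono:
  assumes "E \<subseteq> E'" "0 < n"
  shows "degen n E \<le> degen n E'"
proof -
  let ?D = "\<lambda>E. {Min (induced_degree E S ` S) | S. S \<subseteq> {..<n} \<and> S \<noteq> {}}"
  have fin: "finite (?D E)" for E
    by (rule finite_subset[of _ "(\<lambda>S. Min (induced_degree E S ` S)) ` Pow {..<n}"]) auto
  have "{..<n} \<noteq> {}" using assms(2) by auto
  then have "degen n E \<in> ?D E"
    unfolding degen_def by (intro Max_in fin) blast
  then obtain S where S: "S \<subseteq> {..<n}" "S \<noteq> {}" "degen n E = Min (induced_degree E S ` S)" by blast
  have fS: "finite S" using S(1) finite_subset by blast
  have "Min (induced_degree E S ` S) \<le> induced_degree E' S v" if "v \<in> S" for v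
  proof -
    have "Min (induced_degree E S ` S) \<le> induced_degree E S v" using fS that by simp
    also have "\<dots> \<le> induced_degree E' S v"
      unfolding induced_degree_def using fS assms(1) by (intro card_mono) auto
    finally show ?thesis .
  qed
  then have "Min (induced_degree E S ` S) \<le> Min (induced_degree E' S ` S)"
    using fS S(2) by (intro Min.boundedI) auto
  also have "\<dots> \<le> degen n E'"
    unfolding degen_def using S by (intro Max_ge fin) blast
  finally show ?thesis using S(3) by simp
qed

text \<open>Below the supremum defining \<open>c_const k\<close> there is a larger constant c' whose
  probabilities tend to 0; having degeneracy at least k is an increasing property, so they dominate
  those for c.\<close>

lemma degen_prob_tendsto_0:
  assumes "0 < c" "ereal c < c_const k"
  shows "(\<lambda>n. prob_gnp n (c / real n) (\<lambda>E. k \<le> degen n E)) \<longlonglongrightarrow> 0"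
proof -
  obtain c' where c': "c < c'" "(\<lambda>n. prob_gnp n (c' / real n) (\<lambda>E. k \<le> degen n E)) \<longlonglongrightarrow> 0"
    using assms(2) by (auto simp: c_const_def less_Sup_iff)
  \<comment> \<open>From here on c' / n is a genuine probability.\<close>
  have ev: "\<forall>\<^sub>F n in sequentially. c' \<le> real n \<and> 0 < n"
    using eventually_conj[OF eventually_ge_at_top[of "nat \<lceil>c'\<rceil>"] eventually_gt_at_top[of 0]]
    by eventually_elim linarith
  show ?thesis
  proof (rule tendsto_sandwich[OF _ _ tendsto_const c'(2)])
    show "\<forall>\<^sub>F n in sequentially. 0 \<le> prob_gnp n (c / real n) (\<lambda>E. k \<le> degen n E)"
      using ev
    proof eventually_elim
      case (elim n)
      then have "gnp_expectation (all_edges n) (c / real n) (\<lambda>_. 0) \<le> prob_gnp n (c / real n) (\<lambda>E. k \<le> degen n E)"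
        unfolding prob_gnp_eq using assms(1) c'(1) by (intro gnp_expectation_mono) auto
      then show ?case by (simp add: gnp_expectation_const[OF finite_all_edges])
    qed
    show "\<forall>\<^sub>F n in sequentially. prob_gnp n (c / real n) (\<lambda>E. k \<le> degen n E)
        \<le> prob_gnp n (c' / real n) (\<lambda>E. k \<le> degen n E)"
      using ev
    proof eventually_elim
      case (elim n)
      have "(of_bool (k \<le> degen n E) :: real) \<le> of_bool (k \<le> degen n E')" if "E \<subseteq> E'" for E E'
        using degen_mono[OF that, of n] elim by auto
      then show ?case
        unfolding prob_gnp_eq using elim assms(1) c'(1)
        by (intro gnp_expectation_mono_prob finite_all_edges) (auto simp: divide_right_mono)
    qed
  qed
qed

theorem theorem5p1:
  fixes k m :: nat and c :: real
  assumes "k \<ge> 2" and "0 < c" and "ereal c < c_const (k + 1)" and "m \<ge> 3"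
  shows "(\<lambda>n. prob_gnp n (c / real n)
            (\<lambda>E. M_conn n E m \<ge> ereal (real_of_int (int m - int k - 2)))) \<longlonglongrightarrow> 1"
proof -
  let ?Q = "\<lambda>n E. M_conn n E m \<ge> ereal (real_of_int (int m - int k - 2))"
  let ?D = "\<lambda>n E. k + 1 \<le> degen n E"
  have ev: "\<forall>\<^sub>F n in sequentially. c \<le> real n \<and> 0 < n"
    using eventually_conj[OF eventually_ge_at_top[of "nat \<lceil>c\<rceil>"] eventually_gt_at_top[of 0]]
    by eventually_elim linarith
  have lim: "(\<lambda>n. 1 - prob_gnp n (c / real n) (?D n)) \<longlonglongrightarrow> 1"
    using tendsto_diff[OF tendsto_const[of 1] degen_prob_tendsto_0[OF assms(2,3)]] by simp
  show ?thesis
  proof (rule tendsto_sandwich[OF _ _ lim tendsto_const])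
    \<comment> \<open>Every edge set of degeneracy at most k satisfies the bound, so the complement
      of the rare event lies in the event in question.\<close>
    show "\<forall>\<^sub>F n in sequentially. 1 - prob_gnp n (c / real n) (?D n) \<le> prob_gnp n (c / real n) (?Q n)"
      using ev
    proof eventually_elim
      case (elim n)
      let ?p = "c / real n"
      have "gnp_expectation (all_edges n) ?p (\<lambda>E. 1 - of_bool (?D n E))
          \<le> gnp_expectation (all_edges n) ?p (\<lambda>E. of_bool (?Q n E))"
      proof (rule gnp_expectation_mono)
        show "(1 - of_bool (?D n E) :: real) \<le> of_bool (?Q n E)" if "E \<subseteq> all_edges n" for E
          using M_conn_ge[OF that, of k m] by (cases "?D n E") auto
      qed (use elim assms(2) in auto)
      moreover have "gnp_expectation (all_edges n) ?p (\<lambda>E. 1 - of_bool (?D n E))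
          = gnp_expectation (all_edges n) ?p (\<lambda>_. 1) - gnp_expectation (all_edges n) ?p (\<lambda>E. of_bool (?D n E))"
        by (simp add: gnp_expectation_def left_diff_distrib sum_subtractf)
      ultimately show ?case
        by (simp add: prob_gnp_eq gnp_expectation_const[OF finite_all_edges])
    qed
    show "\<forall>\<^sub>F n in sequentially. prob_gnp n (c / real n) (?Q n) \<le> 1"
      using ev
    proof eventually_elim
      case (elim n)
      then have "prob_gnp n (c / real n) (?Q n) \<le> gnp_expectation (all_edges n) (c / real n) (\<lambda>_. 1)"
        unfolding prob_gnp_eq using assms(2) by (intro gnp_expectation_mono) auto
      then show ?case by (simp add: gnp_expectation_const[OF finite_all_edges])
    qed
  qed
qed

end
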